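(* Let $\eta$ be a nilpotent endomorphism of an $n$-dimensional vector space $V$ over an infinite field, and let $\mathcal F_\eta$ be the variety of $\eta$-stable complete flags in $V$. There is a dense open subset $\mathcal F_\eta'$ of $\mathcal F_\eta$ such that for all $f\in\mathcal F_\eta'$ the following holds: if for $i,j\ge 0$ with $i+j\le n$ one puts $\lambda^{[i,j]}=J(\eta_{f_{n-j}/f_i})$, then every configuration $$\begin{pmatrix}\lambda^{[i,j]}&\lambda^{[i,j+1]}\\ \lambda^{[i+1,j]}&\lambda^{[i+1,j+1]}\end{pmatrix}\qquad(i,j\ge0,\ i+j+2\le n)$$ is either of type $S1$ or of type $S2$.
   Context: Varieties carry the Zariski topology. A complete flag $f$ in $V$ is a chain $0=f_0\subset f_1\subset\cdots\subset f_n=V$ with $\dim f_i=i$; it is $\eta$-stable if $\eta(f_i)\subset f_i$ for all $i$. For $\eta$-stable subspaces $V'\subset V''$, $\eta_{V''/V'}$ denotes the nilpotent endomorphism of $V''/V'$ induced by $\eta$. For a nilpotent endomorphism $\xi$ of a finite dimensional space, $J(\xi)$ is its Jordan type: the partition whose parts are the sizes of its Jordan blocks. A partition $\lambda$ is a weakly decreasing sequence $\lambda_0\ge\lambda_1\ge\cdots$ of natural numbers with finite sum $|\lambda|$, with Young diagram $Y(\lambda)=\{(i,j)\in\mathbb N\times\mathbb N: j<\lambda_i\}$. Write $\mu\prec\lambda$ if $Y(\mu)\subset Y(\lambda)$ and $|\mu|=|\lambda|-1$; then $\lambda-\mu$ denotes the unique square of $Y(\lambda)\setminus Y(\mu)$.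 Two squares are adjacent if they share an edge. An arrangement of four partitions $\begin{pmatrix}\lambda&\mu\\ \mu'&\nu\end{pmatrix}$ with $\nu\prec\mu\prec\lambda$ and $\nu\prec\mu'\prec\lambda$ is of type $S1$ if $\mu=\mu'$ and the squares $\mu-\nu$ and $\lambda-\mu$ are adjacent; it is of type $S2$ if $\mu\ne\mu'$. *)

theory Defs
  imports "HOL-Analysis.Abstract_Topology" "Jordan_Normal_Form.Determinant"
begin

section \<open>Partitions\<close>

definition is_partition :: "(nat \<Rightarrow> nat) \<Rightarrow> bool" where
  "is_partition \<kappa> \<longleftrightarrow> antimono \<kappa> \<and> finite {i. \<kappa> i \<noteq> 0}"

definition partition_size :: "(nat \<Rightarrow> nat) \<Rightarrow> nat" where
  "partition_size \<kappa> = (\<Sum>i | \<kappa> i \<noteq> 0. \<kappa> i)"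

definition young_diagram :: "(nat \<Rightarrow> nat) \<Rightarrow> (nat \<times> nat) set" where
  "young_diagram \<kappa> = {(i, j). j < \<kappa> i}"

definition covered_by :: "(nat \<Rightarrow> nat) \<Rightarrow> (nat \<Rightarrow> nat) \<Rightarrow> bool" (infix \<open>\<prec>\<^sub>Y\<close> 50) where
  "\<mu> \<prec>\<^sub>Y \<kappa> \<longleftrightarrow> is_partition \<mu> \<and> is_partition \<kappa> \<and>
     young_diagram \<mu> \<subseteq> young_diagram \<kappa> \<and> partition_size \<kappa> = partition_size \<mu> + 1"

definition added_square :: "(nat \<Rightarrow> nat) \<Rightarrow> (nat \<Rightarrow> nat) \<Rightarrow> nat \<times> nat" where
  "added_square \<kappa> \<mu> = (THE s. s \<in> young_diagram \<kappa> - young_diagram \<mu>)"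

fun adjacent :: "nat \<times> nat \<Rightarrow> nat \<times> nat \<Rightarrow> bool" where
  "adjacent (i, j) (i', j') \<longleftrightarrow>
     i = i' \<and> (j' = Suc j \<or> j = Suc j') \<or> j = j' \<and> (i' = Suc i \<or> i = Suc i')"

text \<open>Arguments are in the order top left, top right, bottom left, bottom right.\<close>

definition arrangement ::
    "(nat \<Rightarrow> nat) \<Rightarrow> (nat \<Rightarrow> nat) \<Rightarrow> (nat \<Rightarrow> nat) \<Rightarrow> (nat \<Rightarrow> nat) \<Rightarrow> bool" where
  "arrangement \<kappa> \<mu> \<mu>' \<nu> \<longleftrightarrow> \<nu> \<prec>\<^sub>Y \<mu> \<and> \<mu> \<prec>\<^sub>Y \<kappa> \<and> \<nu> \<prec>\<^sub>Y \<mu>' \<and> \<mu>' \<prec>\<^sub>Y \<kappa>"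

definition type_S1 ::
    "(nat \<Rightarrow> nat) \<Rightarrow> (nat \<Rightarrow> nat) \<Rightarrow> (nat \<Rightarrow> nat) \<Rightarrow> (nat \<Rightarrow> nat) \<Rightarrow> bool" where
  "type_S1 \<kappa> \<mu> \<mu>' \<nu> \<longleftrightarrow>
     arrangement \<kappa> \<mu> \<mu>' \<nu> \<and> \<mu> = \<mu>' \<and> adjacent (added_square \<mu> \<nu>) (added_square \<kappa> \<mu>)"

definition type_S2 ::
    "(nat \<Rightarrow> nat) \<Rightarrow> (nat \<Rightarrow> nat) \<Rightarrow> (nat \<Rightarrow> nat) \<Rightarrow> (nat \<Rightarrow> nat) \<Rightarrow> bool" where
  "type_S2 \<kappa> \<mu> \<mu>' \<nu> \<longleftrightarrow> arrangement \<kappa> \<mu> \<mu>' \<nu> \<and> \<mu> \<noteq> \<mu>'"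


section \<open>Jordan types of subquotients\<close>

text \<open>Elements of a quotient \<open>W/U\<close> are the cosets \<open>v + U\<close> with \<open>v \<in> W\<close>.\<close>

definition coset :: "'b::ab_group_add set \<Rightarrow> 'b \<Rightarrow> 'b set" where
  "coset U v = {v + u | u. u \<in> U}"

definition induced :: "('b::ab_group_add \<Rightarrow> 'b) \<Rightarrow> 'b set \<Rightarrow> 'b set \<Rightarrow> 'b set" where
  "induced \<eta> U C = (\<Union>v\<in>C. coset U (\<eta> v))"

context finite_dimensional_vector_space
begin

definition nilpotent_endomorphism :: "('b \<Rightarrow> 'b) \<Rightarrow> bool" where
  "nilpotent_endomorphism \<eta> \<longleftrightarrow> Vector_Spaces.linear scale scale \<eta> \<and> (\<exists>k. \<forall>v. (\<eta> ^^ k) v = 0)"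

lemma coset_eq_iff:
  assumes "subspace U"
  shows "coset U v = coset U w \<longleftrightarrow> v - w \<in> U"
proof
  assume "coset U v = coset U w"
  moreover have "v \<in> coset U v"
    unfolding coset_def using subspace_0[OF assms] by force
  ultimately show "v - w \<in> U"
    unfolding coset_def by auto
next
  assume vw: "v - w \<in> U"
  have "v + u = w + (v - w + u)" "w + u = v + (u - (v - w))" for u
    by (simp_all add: algebra_simps)
  then show "coset U v = coset U w"
    unfolding coset_def using subspace_add[OF assms vw] subspace_diff[OF assms _ vw] by blast
qed

lemma induced_coset:
  assumes "subspace U" "Vector_Spaces.linear scale scale \<eta>" "\<eta> ` U \<subseteq> U"
  shows "induced \<eta> U (coset U v) = coset U (\<eta> v)"
proof -
  interpret \<eta>: Vector_Spaces.linear scale scale \<eta> by fact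
  have "coset U (\<eta> w) = coset U (\<eta> v)" if "w \<in> coset U v" for w
  proof -
    have "w - v \<in> U" using that by (auto simp: coset_def)
    then have "\<eta> (w - v) \<in> U" using assms(3) by blast
    then show ?thesis by (simp add: coset_eq_iff[OF assms(1)] \<eta>.diff)
  qed
  moreover have "v \<in> coset U v"
    unfolding coset_def using subspace_0[OF assms(1)] by force
  ultimately show ?thesis unfolding induced_def by blast
qed

text \<open>The cosets of the vectors \<open>e (i, j)\<close>, for \<open>(i, j)\<close> in the Young diagram of \<open>\<kappa>\<close>, form
  a Jordan basis of \<open>W/U\<close> for the endomorphism induced by \<open>\<eta>\<close>: row \<open>i\<close> is a Jordan block of
  size \<open>\<kappa> i\<close>.\<close>

definition jordan_basis ::
    "('b \<Rightarrow> 'b) \<Rightarrow> 'b set \<Rightarrow> 'b set \<Rightarrow> (nat \<Rightarrow> nat) \<Rightarrow> (nat \<times> nat \<Rightarrow> 'b) \<Rightarrow> bool" where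
  "jordan_basis \<eta> W U \<kappa> e \<longleftrightarrow>
     (\<forall>s\<in>young_diagram \<kappa>. e s \<in> W) \<and>
     (\<forall>v\<in>W. \<exists>!c. (\<forall>s. s \<notin> young_diagram \<kappa> \<longrightarrow> c s = 0) \<and>
                coset U v = coset U (\<Sum>s\<in>young_diagram \<kappa>. scale (c s) (e s))) \<and>
     (\<forall>(i, j)\<in>young_diagram \<kappa>. induced \<eta> U (coset U (e (i, j))) =
                coset U (case j of 0 \<Rightarrow> 0 | Suc k \<Rightarrow> e (i, k)))"

text \<open>\<open>jordan_type \<eta> W U\<close> is \<open>J(\<eta>\<^bsub>W/U\<^esub>)\<close>, for \<open>\<eta>\<close>-stable subspaces \<open>U \<subseteq> W\<close>.\<close>

definition jordan_type :: "('b \<Rightarrow> 'b) \<Rightarrow> 'b set \<Rightarrow> 'b set \<Rightarrow> nat \<Rightarrow> nat" where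
  "jordan_type \<eta> W U = (THE \<kappa>. is_partition \<kappa> \<and> (\<exists>e. jordan_basis \<eta> W U \<kappa> e))"


section \<open>Complete flags\<close>

definition complete_flag :: "(nat \<Rightarrow> 'b set) \<Rightarrow> bool" where
  "complete_flag f \<longleftrightarrow>
     f \<in> extensional {..dim UNIV} \<and> f 0 = {0} \<and> f (dim UNIV) = UNIV \<and>
     (\<forall>i\<le>dim UNIV. subspace (f i) \<and> dim (f i) = i) \<and>
     (\<forall>i<dim UNIV. f i \<subset> f (Suc i))"

definition stable_flags :: "('b \<Rightarrow> 'b) \<Rightarrow> (nat \<Rightarrow> 'b set) set" where
  "stable_flags \<eta> = {f. complete_flag f \<and> (\<forall>i\<le>dim UNIV. \<eta> ` f i \<subseteq> f i)}"

definition flag_type :: "('b \<Rightarrow> 'b) \<Rightarrow> (nat \<Rightarrow> 'b set) \<Rightarrow> nat \<Rightarrow> nat \<Rightarrow> nat \<Rightarrow> nat" where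
  "flag_type \<eta> f i j = jordan_type \<eta> (f (dim UNIV - j)) (f i)"


section \<open>The Zariski topology on the flag variety\<close>

text \<open>
  The flag variety is embedded in the product over \<open>i\<close> of the projective spaces of the
  exterior powers of degree \<open>i\<close> of the space by the Pluecker embeddings of the Grassmannians.
  The homogeneous coordinates on factor \<open>i\<close> are indexed by lists \<open>I\<close> of \<open>i\<close> basis vectors: if
  \<open>vs\<close> is a basis of \<open>f i\<close>, the coordinate at \<open>I\<close> is the minor on the columns \<open>I\<close> of the matrix
  whose rows are the coordinate vectors of \<open>vs\<close>. Lists with repetitions (coordinate 0) or in a
  different order (coordinate up to sign) are redundant but harmless.
  Closed sets are the common zero sets of multihomogeneous polynomials in these coordinates.
\<close>

definition plucker :: "'b list \<Rightarrow> 'b list \<Rightarrow> 'a" where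
  "plucker vs I =
     det (mat (length I) (length I) (\<lambda>(r, c). representation Basis (vs ! r) (I ! c)))"

definition homogeneous_coords :: "(nat \<Rightarrow> 'b set) \<Rightarrow> ('b list \<Rightarrow> 'a) \<Rightarrow> bool" where
  "homogeneous_coords f x \<longleftrightarrow>
     (\<forall>i\<le>dim UNIV. \<exists>vs. length vs = i \<and> span (set vs) = f i \<and>
        (\<forall>I. length I = i \<and> set I \<subseteq> Basis \<longrightarrow> x I = plucker vs I))"

text \<open>\<open>multihom d p\<close>: the function \<open>p\<close> is given by a polynomial that is homogeneous of degree
  \<open>d i\<close> in the coordinates of factor \<open>i\<close>, for each \<open>i\<close>.\<close>

inductive multihom :: "(nat \<Rightarrow> nat) \<Rightarrow> (('b list \<Rightarrow> 'a) \<Rightarrow> 'a) \<Rightarrow> bool" where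
  const: "multihom (\<lambda>_. 0) (\<lambda>_. a)"
| coord: "set I \<subseteq> Basis \<Longrightarrow> length I \<le> dim UNIV \<Longrightarrow>
          multihom (\<lambda>i. if i = length I then 1 else 0) (\<lambda>x. x I)"
| add: "multihom d p \<Longrightarrow> multihom d q \<Longrightarrow> multihom d (\<lambda>x. p x + q x)"
| mult: "multihom d p \<Longrightarrow> multihom d' q \<Longrightarrow> multihom (\<lambda>i. d i + d' i) (\<lambda>x. p x * q x)"

definition zero_set :: "(('b list \<Rightarrow> 'a) \<Rightarrow> 'a) set \<Rightarrow> (nat \<Rightarrow> 'b set) set" where
  "zero_set S = {f. complete_flag f \<and> (\<forall>x. homogeneous_coords f x \<longrightarrow> (\<forall>p\<in>S. p x = 0))}"

definition zariski_closed :: "(nat \<Rightarrow> 'b set) set \<Rightarrow> bool" where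
  "zariski_closed Z \<longleftrightarrow> (\<exists>S. (\<forall>p\<in>S. \<exists>d. multihom d p) \<and> Z = zero_set S)"

definition flag_topology :: "(nat \<Rightarrow> 'b set) topology" where
  "flag_topology =
     topology (\<lambda>U. U \<subseteq> Collect complete_flag \<and> zariski_closed (Collect complete_flag - U))"

lemma in_span_list:
  assumes "v \<in> span (set ws)"
  shows "\<exists>c. v = (\<Sum>s<length ws. scale (c s) (ws ! s))"
  using assms
proof (induction ws arbitrary: v)
  case Nil
  then show ?case by simp
next
  case (Cons w ws)
  then obtain k where "v - scale k w \<in> span (set ws)"
    by (auto simp: span_breakdown_eq)
  then obtain c where c: "v - scale k w = (\<Sum>s<length ws. scale (c s) (ws ! s))"
    using Cons.IH by blast
  have "v = (\<Sum>s<length (w # ws). scale (case s of 0 \<Rightarrow> k | Suc t \<Rightarrow> c t) ((w # ws) ! s))"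
    using c by (simp add: lessThan_Suc_eq_insert_0 sum.reindex algebra_simps
        del: sum.lessThan_Suc)
  then show ?case
    by (intro exI[of _ "\<lambda>s. case s of 0 \<Rightarrow> k | Suc t \<Rightarrow> c t"])
qed

lemma plucker_change_basis:
  assumes "length vs = length ws" "span (set vs) \<subseteq> span (set ws)"
  shows "\<exists>a. \<forall>I. length I = length ws \<longrightarrow> plucker vs I = a * plucker ws I"
proof -
  let ?n = "length ws"
  have "\<exists>c. vs ! r = (\<Sum>s<?n. scale (c s) (ws ! s))" if "r < ?n" for r
    using that assms by (intro in_span_list) (metis nth_mem span_base subsetD)
  then obtain c where c: "\<And>r. r < ?n \<Longrightarrow> vs ! r = (\<Sum>s<?n. scale (c r s) (ws ! s))"
    by metis
  let ?A = "mat ?n ?n (\<lambda>(r, s). c r s)"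
  have "plucker vs I = det ?A * plucker ws I" if "length I = ?n" for I
  proof -
    let ?M = "\<lambda>us. mat ?n ?n (\<lambda>(r, s). representation Basis (us ! r) (I ! s))"
    have "?M vs = ?A * ?M ws"
    proof (rule eq_matI)
      fix r s assume "r < dim_row (?A * ?M ws)" "s < dim_col (?A * ?M ws)"
      then have "r < ?n" "s < ?n" by auto
      then show "?M vs $$ (r, s) = (?A * ?M ws) $$ (r, s)"
        by (simp add: c scalar_prod_def representation_sum[OF independent_Basis]
            representation_scale[OF independent_Basis] span_Basis atLeast0LessThan)
    qed auto
    then show ?thesis
      unfolding plucker_def that using det_mult[of ?A ?n "?M ws"] by simp
  qed
  then show ?thesis by blast
qed

lemma multihom_scaled:
  assumes "multihom d p"
    and "\<And>I. set I \<subseteq> Basis \<Longrightarrow> length I \<le> dim UNIV \<Longrightarrow> y I = t (length I) * x I"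
  shows "p y = (\<Prod>i\<le>dim UNIV. t i ^ d i) * p x"
  using assms(1)
proof induction
  case (coord I)
  have "(\<Prod>i\<le>dim UNIV. t i ^ (if i = length I then 1 else 0)) = t (length I)"
    using coord(2) by (simp add: if_distrib cong: if_cong)
  then show ?case using coord assms(2) by simp
qed (simp_all add: algebra_simps power_add prod.distrib)

lemma multihom_zero_indep:
  assumes "homogeneous_coords f x" "homogeneous_coords f y" "multihom d p" "p x = 0"
  shows "p y = 0"
proof -
  have "\<exists>a. \<forall>I. set I \<subseteq> Basis \<and> length I = i \<longrightarrow> y I = a * x I" if i: "i \<le> dim UNIV" for i
  proof -
    obtain vs ws where vs: "length vs = i" "span (set vs) = f i"
        "\<And>I. length I = i \<Longrightarrow> set I \<subseteq> Basis \<Longrightarrow> x I = plucker vs I"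
      and ws: "length ws = i" "span (set ws) = f i"
        "\<And>I. length I = i \<Longrightarrow> set I \<subseteq> Basis \<Longrightarrow> y I = plucker ws I"
      using assms(1,2) i unfolding homogeneous_coords_def by meson
    then show ?thesis using plucker_change_basis[of ws vs] by auto
  qed
  then obtain t where "\<And>i I. i \<le> dim UNIV \<Longrightarrow> set I \<subseteq> Basis \<Longrightarrow> length I = i \<Longrightarrow> y I = t i * x I"
    by metis
  then show ?thesis using multihom_scaled[OF assms(3)] assms(4) by simp
qed

lemma homogeneous_coords_exist:
  assumes "complete_flag f"
  shows "\<exists>x. homogeneous_coords f x"
proof -
  have "\<exists>vs. length vs = i \<and> span (set vs) = f i" if i: "i \<le> dim UNIV" for i
  proof -
    have f: "subspace (f i)" "dim (f i) = i"
      using assms i by (auto simp: complete_flag_def)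
    obtain b where b: "b \<subseteq> f i" "independent b" "f i \<subseteq> span b" "card b = dim (f i)"
      using basis_exists by blast
    obtain vs where "set vs = b" "distinct vs"
      using finite_distinct_list[OF finiteI_independent[OF b(2)]] by blast
    moreover have "span b = f i"
      using b f span_minimal by blast
    ultimately show ?thesis
      using b f distinct_card by metis
  qed
  then obtain vs where "\<And>i. i \<le> dim UNIV \<Longrightarrow> length (vs i) = i \<and> span (set (vs i)) = f i"
    by metis
  then have "homogeneous_coords f (\<lambda>I. plucker (vs (length I)) I)"
    unfolding homogeneous_coords_def by metis
  then show ?thesis by (rule exI[of "homogeneous_coords f"])
qed

lemma zariski_closed_Un:
  assumes "zariski_closed Y" "zariski_closed Z"
  shows "zariski_closed (Y \<union> Z)"
proof -
  obtain S T where S: "\<And>p. p \<in> S \<Longrightarrow> \<exists>d. multihom d p" "Y = zero_set S"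
    and T: "\<And>p. p \<in> T \<Longrightarrow> \<exists>d. multihom d p" "Z = zero_set T"
    using assms unfolding zariski_closed_def by metis
  let ?P = "{\<lambda>x. p x * q x | p q. p \<in> S \<and> q \<in> T}"
  have "Y \<union> Z = zero_set ?P"
  proof
    show "Y \<union> Z \<subseteq> zero_set ?P"
      unfolding S T zero_set_def by auto
    show "zero_set ?P \<subseteq> Y \<union> Z"
    proof
      fix f assume f: "f \<in> zero_set ?P"
      then have flag: "complete_flag f" by (simp add: zero_set_def)
      obtain x where x: "homogeneous_coords f x"
        using homogeneous_coords_exist[OF flag] by blast
      have "p x * q x = 0" if "p \<in> S" "q \<in> T" for p q
        using f x that unfolding zero_set_def by fastforce
      then have "(\<forall>p\<in>S. p x = 0) \<or> (\<forall>q\<in>T. q x = 0)"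
        by (meson mult_eq_0_iff)
      then show "f \<in> Y \<union> Z"
        unfolding S(2) T(2) zero_set_def using S(1) T(1) flag multihom_zero_indep[OF x] by blast
    qed
  qed
  moreover have "\<forall>r\<in>?P. \<exists>d. multihom d r"
  proof
    fix r assume "r \<in> ?P"
    then obtain p q where r: "r = (\<lambda>x. p x * q x)" "p \<in> S" "q \<in> T" by blast
    obtain d d' where "multihom d p" "multihom d' q" using S(1) T(1) r by meson
    then show "\<exists>d. multihom d r" unfolding r by (blast intro: multihom.mult)
  qed
  ultimately show ?thesis unfolding zariski_closed_def by blast
qed

lemma zariski_closed_INT:
  assumes "\<And>U. U \<in> K \<Longrightarrow> zariski_closed (Collect complete_flag - U)"
  shows "zariski_closed (Collect complete_flag - \<Union>K)"
proof -
  obtain S where S: "\<And>U p. U \<in> K \<Longrightarrow> p \<in> S U \<Longrightarrow> \<exists>d. multihom d p"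
      "\<And>U. U \<in> K \<Longrightarrow> Collect complete_flag - U = zero_set (S U)"
    using assms unfolding zariski_closed_def by metis
  have "Collect complete_flag - \<Union>K = zero_set (\<Union>U\<in>K. S U)"
  proof -
    have "f \<in> Collect complete_flag - \<Union>K \<longleftrightarrow>
        complete_flag f \<and> (\<forall>U\<in>K. f \<in> Collect complete_flag - U)" for f
      by blast
    also have "\<dots> f \<longleftrightarrow> f \<in> zero_set (\<Union>U\<in>K. S U)" for f
      using S(2) by (auto simp: zero_set_def)
    finally show ?thesis by blast
  qed
  moreover have "\<forall>p\<in>(\<Union>U\<in>K. S U). \<exists>d. multihom d p"
    using S(1) by blast
  ultimately show ?thesis unfolding zariski_closed_def by blast
qed

lemma istopology_flags:
  "istopology (\<lambda>U. U \<subseteq> Collect complete_flag \<and> zariski_closed (Collect complete_flag - U))"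
  unfolding istopology_def
proof (intro conjI allI impI; (elim conjE)?)
  fix U V assume "zariski_closed (Collect complete_flag - U)"
    "zariski_closed (Collect complete_flag - V)"
  then show "zariski_closed (Collect complete_flag - U \<inter> V)"
    using zariski_closed_Un by (simp add: Diff_Int)
qed (auto intro: zariski_closed_INT)

lemma openin_flag_topology:
  "openin flag_topology U \<longleftrightarrow>
     U \<subseteq> Collect complete_flag \<and> zariski_closed (Collect complete_flag - U)"
  unfolding flag_topology_def by (simp add: topology_inverse'[OF istopology_flags])

lemma topspace_flag_topology: "topspace flag_topology = Collect complete_flag"
proof -
  have "zariski_closed {}"
    unfolding zariski_closed_def zero_set_def
    using homogeneous_coords_exist multihom.const[of 1]
    by (intro exI[of _ "{\<lambda>_. 1}"]) auto
  then have "openin flag_topology (Collect complete_flag)"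
    by (simp add: openin_flag_topology)
  then show ?thesis
    by (metis openin_flag_topology openin_subset openin_topspace subset_antisym)
qed

definition stable_flag_variety :: "('b \<Rightarrow> 'b) \<Rightarrow> (nat \<Rightarrow> 'b set) topology" where
  "stable_flag_variety \<eta> = subtopology flag_topology (stable_flags \<eta>)"

lemma topspace_stable_flag_variety: "topspace (stable_flag_variety \<eta>) = stable_flags \<eta>"
  by (auto simp: stable_flag_variety_def topspace_flag_topology stable_flags_def)

end

end

theory Submission
  imports Defs
begin

text \<open>
  The dimensions of \<open>\<eta>\<^sup>k f\<^sub>b + f\<^sub>a\<close> determine all the Jordan types and are lower semicontinuous in
  the flag, so they are locally constant on a dense open set. Let \<open>f\<close> lie in that set and suppose
  that the configuration for \<open>U = f\<^sub>i\<close>, \<open>L = f\<^sub>i\<^sub>+\<^sub>1\<close>, \<open>H = f\<^sub>n\<^sub>-\<^sub>j\<^sub>-\<^sub>1\<close>, \<open>W = f\<^sub>n\<^sub>-\<^sub>j\<close> has \<open>\<mu> = \<mu>'\<close>,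
  where \<open>\<mu>\<close> arises from the type of \<open>W/U\<close> by removing a square in column \<open>c\<close>. The line \<open>L/U\<close> then
  lies in the image of \<open>\<eta>\<^sup>c\<close> on \<open>W/U\<close>, so \<open>\<mu> - \<nu>\<close> is in column \<open>c\<close> or \<open>c - 1\<close>. If it is not
  adjacent to the first square, it is in column \<open>c - 1\<close> and \<open>\<mu>\<close> has two rows of length \<open>c\<close>. This gives
  an endomorphism \<open>a\<close> of \<open>V\<close> with \<open>a\<^sup>2 = 0\<close> that induces an \<open>\<eta>\<close>-equivariant map on \<open>H/U\<close> and moves
  \<open>L/U\<close> out of that image. The flags \<open>(1 + t a) f\<close> are \<open>\<eta>\<close>-stable and form a rational curve through
  \<open>f\<close>, along which the dimension of \<open>\<eta>\<^sup>c f\<^sub>n\<^sub>-\<^sub>j + f\<^sub>i\<^sub>+\<^sub>1\<close> jumps as soon as \<open>t \<noteq> 0\<close>; this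
  contradicts local constancy because the field is infinite.
\<close>

section \<open>Partitions by columns\<close>

text \<open>The entries of the conjugate partition. Differences of consecutive ranks give exactly
  these numbers, so Jordan types are compared column by column.\<close>

definition column_length :: "(nat \<Rightarrow> nat) \<Rightarrow> nat \<Rightarrow> nat" where
  "column_length \<kappa> k = card {i. k < \<kappa> i}"

lemma finite_column: "is_partition \<kappa> \<Longrightarrow> finite {i. k < \<kappa> i}"
  unfolding is_partition_def by (rule finite_subset[of _ "{i. \<kappa> i \<noteq> 0}"]) auto

text \<open>The rows longer than \<open>k\<close> form a finite, downward closed set of indices,
  hence an initial segment determined by its cardinality.\<close>

lemma less_partition_iff:
  assumes "is_partition \<kappa>"
  shows "k < \<kappa> i \<longleftrightarrow> i < column_length \<kappa> k"
proof -
  let ?A = "{i. k < \<kappa> i}"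
  have fin: "finite ?A" by (rule finite_column[OF assms])
  have down: "j \<in> ?A" if "i \<in> ?A" "j \<le> i" for i j
    using assms that unfolding is_partition_def antimono_def by (force dest: order_less_le_trans)
  have "?A = {..<card ?A}"
  proof (cases "?A = {}")
    case False
    then have "?A = {..Max ?A}"
      using down fin by (auto simp: Max_in dest: Max_in[OF fin False, THEN down])
    then have "?A = {..<Suc (Max ?A)}" by (simp add: lessThan_Suc_atMost)
    then show ?thesis by (metis card_lessThan)
  qed auto
  then show ?thesis unfolding column_length_def by blast
qed

lemma young_diagram_column_length:
  "is_partition \<kappa> \<Longrightarrow> young_diagram \<kappa> = {(i, j). i < column_length \<kappa> j}"
  by (auto simp: young_diagram_def less_partition_iff)

lemma young_diagram_Sigma: "young_diagram \<kappa> = (SIGMA i:{i. \<kappa> i \<noteq> 0}. {..<\<kappa> i})"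
  by (auto simp: young_diagram_def)

lemma finite_young_diagram: "is_partition \<kappa> \<Longrightarrow> finite (young_diagram \<kappa>)"
  by (simp add: young_diagram_Sigma is_partition_def)

lemma card_young_diagram: "is_partition \<kappa> \<Longrightarrow> card (young_diagram \<kappa>) = partition_size \<kappa>"
  by (simp add: young_diagram_Sigma is_partition_def partition_size_def)

lemma partition_eqI:
  assumes "is_partition \<kappa>" "is_partition \<mu>" "\<And>k. column_length \<kappa> k = column_length \<mu> k"
  shows "\<kappa> = \<mu>"
proof
  fix i
  have "k < \<kappa> i \<longleftrightarrow> k < \<mu> i" for k
    using assms by (simp add: less_partition_iff)
  then show "\<kappa> i = \<mu> i" by (meson linorder_neqE_nat less_irrefl)
qed

lemma column_length_antimono: "is_partition \<kappa> \<Longrightarrow> column_length \<kappa> (Suc k) \<le> column_length \<kappa> k"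
  unfolding column_length_def by (rule card_mono) (auto simp: finite_column)

text \<open>Turns a difference of ranks into a covering together with the position of the added
  square. Rows count from 0, so the old length of column \<open>c\<close> is the row of the new
  square.\<close>

lemma covered_by_column:
  assumes "is_partition \<kappa>" "is_partition \<mu>"
    and "\<And>k. column_length \<kappa> k = column_length \<mu> k + (if k = c then 1 else 0)"
  shows "\<mu> \<prec>\<^sub>Y \<kappa>" and "added_square \<kappa> \<mu> = (column_length \<mu> c, c)"
proof -
  have notin: "(column_length \<mu> c, c) \<notin> young_diagram \<mu>"
    by (simp add: young_diagram_column_length[OF assms(2)])
  have Y: "young_diagram \<kappa> = insert (column_length \<mu> c, c) (young_diagram \<mu>)"
    by (auto simp: young_diagram_column_length assms split: if_splits)
  then have "partition_size \<kappa> = partition_size \<mu> + 1"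
    using notin assms(1,2)
    by (simp flip: card_young_diagram add: finite_young_diagram)
  then show "\<mu> \<prec>\<^sub>Y \<kappa>"
    unfolding covered_by_def using Y assms by auto
  have "young_diagram \<kappa> - young_diagram \<mu> = {(column_length \<mu> c, c)}"
    using Y notin by auto
  then show "added_square \<kappa> \<mu> = (column_length \<mu> c, c)"
    unfolding added_square_def by simp
qed

text \<open>Each row loses its last \<open>k\<close> squares, not its first, because \<eta> lowers
  the column index in a Jordan basis: the remaining squares index a basis of the image of
  \<eta>^k.\<close>

definition diagram_from :: "(nat \<Rightarrow> nat) \<Rightarrow> nat \<Rightarrow> (nat \<times> nat) set" where
  "diagram_from \<kappa> k = {(i, j). j + k < \<kappa> i}"

lemma diagram_from_subset: "diagram_from \<kappa> k \<subseteq> young_diagram \<kappa>"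
  by (auto simp: diagram_from_def young_diagram_def)

text \<open>Column 0 consists of the rows longer than \<open>k\<close>; all other squares are those
  of \<open>diagram_from \<kappa> (Suc k)\<close> moved one step to the right.\<close>

lemma card_diagram_from:
  assumes "is_partition \<kappa>"
  shows "card (diagram_from \<kappa> k) = column_length \<kappa> k + card (diagram_from \<kappa> (Suc k))"
proof -
  let ?A = "(\<lambda>i. (i, 0::nat)) ` {i. k < \<kappa> i}" and ?B = "apsnd Suc ` diagram_from \<kappa> (Suc k)"
  have eq: "diagram_from \<kappa> k = ?A \<union> ?B"
  proof -
    have "(i, j) \<in> diagram_from \<kappa> k \<longleftrightarrow> (i, j) \<in> ?A \<union> ?B" for i j
      by (cases j) (auto simp: diagram_from_def image_iff)
    then show ?thesis by auto
  qed
  have fin: "finite (diagram_from \<kappa> m)" for m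
    by (rule finite_subset[OF diagram_from_subset finite_young_diagram[OF assms]])
  have "card (diagram_from \<kappa> k) = card ?A + card ?B"
    unfolding eq using fin finite_column[OF assms] by (intro card_Un_disjoint) auto
  also have "card ?A = column_length \<kappa> k"
    unfolding column_length_def by (rule card_image) (auto simp: inj_on_def)
  also have "card ?B = card (diagram_from \<kappa> (Suc k))"
    by (rule card_image) (auto simp: inj_on_def)
  finally show ?thesis .
qed

section \<open>Ranks of powers on subquotients\<close>

text \<open>The threshold \<open>c\<close> will be the column of the square by which two Jordan
  types differ.\<close>

lemma decreasing_predicate_threshold:
  assumes "P 0" "\<not> P N" "\<And>k. P (Suc k) \<Longrightarrow> P k"
  shows "\<exists>c. \<forall>k. P k \<longleftrightarrow> k \<le> (c::nat)"
proof -
  have down: "P m" if "P k" "m \<le> k" for k m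
    using that(2,1) by (induction k rule: dec_induct) (auto intro: assms(3))
  define c where "c = (LEAST k. \<not> P k)"
  have c: "\<not> P c" unfolding c_def by (rule LeastI[of _ N]) (rule assms(2))
  have c': "P k" if "k < c" for k using that not_less_Least unfolding c_def by blast
  have "c > 0" using c assms(1) by (cases c) auto
  have "P k \<longleftrightarrow> k \<le> c - 1" for k
    using c c' down[of k c] \<open>c > 0\<close> by (cases "k < c") auto
  then show ?thesis by blast
qed

section \<open>Linear algebra modulo a subspace\<close>

context finite_dimensional_vector_space
begin

text \<open>Take the coordinate at \<open>v\<close> for a basis that contains \<open>v\<close> and a
  basis of \<open>S\<close>.\<close>

lemma exists_functional:
  assumes "subspace S" "v \<notin> S"
  shows "\<exists>\<phi>. Vector_Spaces.linear scale (*) \<phi> \<and> (\<forall>x\<in>S. \<phi> x = 0) \<and> \<phi> v = 1"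
proof -
  obtain B where B: "B \<subseteq> S" "independent B" "S \<subseteq> span B" "card B = dim S"
    using basis_exists .
  have S: "span B = S"
    using B assms(1) span_minimal by blast
  have ind: "independent (insert v B)"
    using B S assms(2) by (simp add: independent_insertI)
  define E where "E = extend_basis (insert v B)"
  have E: "independent E" "span E = UNIV" "insert v B \<subseteq> E"
    unfolding E_def using ind extend_basis_superset[OF ind] by (simp_all add: independent_extend_basis)
  have "representation E x v = 0" if "x \<in> S" for x
  proof -
    have "representation E x = representation B x"
      using E B S that by (intro representation_extend) auto
    moreover have "v \<notin> B" using B assms(2) by blast
    ultimately show ?thesis
      using representation_ne_zero by metis
  qed
  moreover have "representation E v v = 1"
    using E by (simp add: representation_basis)
  moreover have "Vector_Spaces.linear scale (*) (\<lambda>x. representation E x v)"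
    using linear_representation[OF E(1,2)] .
  ultimately show ?thesis by blast
qed

lemma mem_span_Un_iff:
  assumes "subspace U" "finite S"
  shows "x \<in> span (U \<union> e ` S) \<longleftrightarrow> (\<exists>c. x - (\<Sum>s\<in>S. c s *s e s) \<in> U)"
  using assms(2)
proof (induction S arbitrary: x)
  case empty
  then show ?case using assms(1) by (simp add: span_eq_iff[THEN iffD2])
next
  case (insert a S)
  have "x \<in> span (U \<union> e ` insert a S) \<longleftrightarrow> (\<exists>k. x - k *s e a \<in> span (U \<union> e ` S))"
    by (simp add: span_breakdown_eq)
  also have "\<dots> \<longleftrightarrow> (\<exists>k c. x - k *s e a - (\<Sum>s\<in>S. c s *s e s) \<in> U)"
    by (simp add: insert.IH)
  also have "\<dots> \<longleftrightarrow> (\<exists>c. x - (\<Sum>s\<in>insert a S. c s *s e s) \<in> U)"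
  proof (intro iffI; elim exE)
    fix k c assume *: "x - k *s e a - (\<Sum>s\<in>S. c s *s e s) \<in> U"
    have "(\<Sum>s\<in>S. (c(a := k)) s *s e s) = (\<Sum>s\<in>S. c s *s e s)"
      using insert.hyps by (intro sum.cong) auto
    then have "x - (\<Sum>s\<in>insert a S. (c(a := k)) s *s e s) \<in> U"
      using * insert.hyps by (simp add: algebra_simps)
    then show "\<exists>c. x - (\<Sum>s\<in>insert a S. c s *s e s) \<in> U" by blast
  next
    fix c assume "x - (\<Sum>s\<in>insert a S. c s *s e s) \<in> U"
    then have "x - c a *s e a - (\<Sum>s\<in>S. c s *s e s) \<in> U"
      using insert.hyps by (simp add: algebra_simps)
    then show "\<exists>k c. x - k *s e a - (\<Sum>s\<in>S. c s *s e s) \<in> U" by blast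
  qed
  finally show ?case .
qed

text \<open>Linear independence of the cosets in the quotient by \<open>U\<close>, stated without
  forming the quotient. It concerns an indexed family, so for a subspace \<open>U\<close> a repeated
  vector makes it fail.\<close>

definition independent_mod :: "'b set \<Rightarrow> 'c set \<Rightarrow> ('c \<Rightarrow> 'b) \<Rightarrow> bool" where
  "independent_mod U S e \<longleftrightarrow> (\<forall>c. (\<Sum>s\<in>S. c s *s e s) \<in> U \<longrightarrow> (\<forall>s\<in>S. c s = 0))"

lemma independent_mod_subset:
  assumes "independent_mod U S e" "T \<subseteq> S" "finite S"
  shows "independent_mod U T e"
  unfolding independent_mod_def
proof (intro allI impI)
  fix c assume c: "(\<Sum>s\<in>T. c s *s e s) \<in> U"
  let ?c = "\<lambda>s. if s \<in> T then c s else 0"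
  have "(\<Sum>s\<in>S. ?c s *s e s) = (\<Sum>s\<in>T. ?c s *s e s)"
    using assms by (intro sum.mono_neutral_right) auto
  also have "\<dots> = (\<Sum>s\<in>T. c s *s e s)"
    by (intro sum.cong) auto
  finally have "(\<Sum>s\<in>S. ?c s *s e s) \<in> U" using c by simp
  then have "\<forall>s\<in>S. ?c s = 0"
    by (rule assms(1)[unfolded independent_mod_def, rule_format, THEN ballI])
  then show "\<forall>s\<in>T. c s = 0"
    using assms(2) by (auto dest: bspec)
qed

lemma independent_mod_notin_span:
  assumes "subspace U" "finite S" "independent_mod U S e" "a \<in> S" "T \<subseteq> S - {a}"
  shows "e a \<notin> span (U \<union> e ` T)"
proof
  assume a: "e a \<in> span (U \<union> e ` T)"
  have fin: "finite T" using assms finite_subset by blast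
  have ind: "independent_mod U (insert a T) e"
    using assms by (intro independent_mod_subset[OF assms(3)]) auto
  obtain c where c: "e a - (\<Sum>s\<in>T. c s *s e s) \<in> U"
    using a mem_span_Un_iff[OF assms(1) fin] by blast
  let ?c = "\<lambda>s. if s = a then 1 else - c s"
  have "(\<Sum>s\<in>T. ?c s *s e s) = (\<Sum>s\<in>T. - (c s *s e s))"
    using assms(5) by (intro sum.cong) auto
  moreover have "a \<notin> T" using assms(5) by blast
  ultimately have "(\<Sum>s\<in>insert a T. ?c s *s e s) = e a - (\<Sum>s\<in>T. c s *s e s)"
    using fin by (simp add: sum_negf)
  then have "(\<Sum>s\<in>insert a T. ?c s *s e s) \<in> U" using c by simp
  then have "\<forall>s\<in>insert a T. ?c s = 0"
    by (rule ind[unfolded independent_mod_def, rule_format, THEN ballI])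
  then show False by simp
qed

lemma dim_span_Un_independent_mod:
  assumes "subspace U" "finite S" "independent_mod U S e"
  shows "dim (span (U \<union> e ` S)) = dim U + card S"
  using assms(2,3)
proof (induction S)
  case empty
  then show ?case by simp
next
  case (insert a S)
  have "e a \<notin> span (U \<union> e ` S)"
    using insert by (intro independent_mod_notin_span[OF assms(1), of "insert a S"]) auto
  moreover have "independent_mod U S e"
    using insert by (intro independent_mod_subset[OF insert.prems]) auto
  ultimately show ?case
    using insert by (simp add: dim_insert)
qed

lemma subspace_eq_span_insert:
  assumes "subspace U" "subspace L" "U \<subseteq> L" "dim L = Suc (dim U)" "v \<in> L" "v \<notin> U"
  shows "L = span (insert v U)"
proof -
  have "v \<notin> span U" using assms by (simp add: span_eq_iff[THEN iffD2])
  then have "dim (span (insert v U)) = dim L"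
    using assms by (simp add: dim_insert)
  moreover have "span (insert v U) \<subseteq> L"
    using assms by (intro span_minimal) auto
  ultimately show ?thesis
    using assms(2) subspace_dim_equal[of "span (insert v U)" L] by simp
qed

lemma obtain_complement_vector:
  assumes "subspace U" "subspace L" "U \<subseteq> L" "dim L = Suc (dim U)"
  obtains v where "v \<in> L" "v \<notin> U" "L = span (insert v U)"
proof -
  have "L \<noteq> U" using assms by auto
  then obtain v where "v \<in> L" "v \<notin> U" using assms(3) by blast
  with subspace_eq_span_insert[OF assms] that show ?thesis by blast
qed

lemma mem_span_insert_subspace:
  "subspace U \<Longrightarrow> x \<in> span (insert v U) \<longleftrightarrow> (\<exists>k. x - k *s v \<in> U)"
  by (simp add: span_breakdown_eq span_eq_iff[THEN iffD2])

end

section \<open>Nilpotent endomorphisms and the images of their powers\<close>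

locale nilpotent_endo = finite_dimensional_vector_space scale Basis
  for scale :: "'a::field \<Rightarrow> 'b::ab_group_add \<Rightarrow> 'b" (infixr "*s" 75) and Basis :: "'b set" +
  fixes \<eta> :: "'b \<Rightarrow> 'b"
  assumes nilpotent: "nilpotent_endomorphism \<eta>"
begin

lemma linear_eta: "Vector_Spaces.linear scale scale \<eta>"
  using nilpotent by (simp add: nilpotent_endomorphism_def)

lemma linear_pow: "Vector_Spaces.linear scale scale (\<eta> ^^ k)"
proof (induction k)
  case 0
  then show ?case by (simp add: linear_id flip: id_def)
next
  case (Suc k)
  then show ?case
    using Vector_Spaces.linear_compose[OF Suc linear_eta] by (simp add: comp_def)
qed

sublocale eta: Vector_Spaces.linear scale scale \<eta>
  by (rule linear_eta)

sublocale pow: Vector_Spaces.linear scale scale "\<eta> ^^ k" for k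
  by (rule linear_pow)

lemma pow_eventually_zero: "\<exists>N. \<forall>k\<ge>N. \<forall>x. (\<eta> ^^ k) x = 0"
proof -
  obtain N where N: "\<And>x. (\<eta> ^^ N) x = 0"
    using nilpotent by (auto simp: nilpotent_endomorphism_def)
  have "(\<eta> ^^ k) x = 0" if "k \<ge> N" for k x
    using N pow.zero[of "k - N"] that
    by (metis comp_apply funpow_add le_add_diff_inverse2)
  then show ?thesis by blast
qed

definition invariant :: "'b set \<Rightarrow> bool" where
  "invariant W \<longleftrightarrow> subspace W \<and> \<eta> ` W \<subseteq> W"

lemma invariant_subspace: "invariant W \<Longrightarrow> subspace W"
  by (simp add: invariant_def)

lemma invariant_pow: "invariant W \<Longrightarrow> x \<in> W \<Longrightarrow> (\<eta> ^^ k) x \<in> W"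
  by (induction k) (auto simp: invariant_def)

lemma invariant_eta: "invariant W \<Longrightarrow> x \<in> W \<Longrightarrow> \<eta> x \<in> W"
  by (auto simp: invariant_def)

lemma pow_mono_mem:
  assumes "invariant U" "(\<eta> ^^ k) x \<in> U" "k \<le> m"
  shows "(\<eta> ^^ m) x \<in> U"
proof -
  have "(\<eta> ^^ m) x = (\<eta> ^^ (m - k)) ((\<eta> ^^ k) x)"
    using assms(3) by (metis comp_apply funpow_add le_add_diff_inverse2)
  then show ?thesis using assms invariant_pow by simp
qed

text \<open>For invariant \<open>U\<close> inside \<open>W\<close> this is the preimage in
  \<open>W\<close> of the image of the \<open>k\<close>-th power of the endomorphism induced on
  \<open>W/U\<close>. Its dimension is the rank of that power plus \<open>dim U\<close>.\<close>

definition power_image :: "nat \<Rightarrow> 'b set \<Rightarrow> 'b set \<Rightarrow> 'b set" where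
  "power_image k W U = {(\<eta> ^^ k) w + u | w u. w \<in> W \<and> u \<in> U}"

lemma subspace_power_image: "subspace W \<Longrightarrow> subspace U \<Longrightarrow> subspace (power_image k W U)"
proof -
  assume W: "subspace W" and U: "subspace U"
  have "power_image k W U = {x + y | x y. x \<in> (\<eta> ^^ k) ` W \<and> y \<in> U}"
    unfolding power_image_def by blast
  then show ?thesis
    using subspace_sums[OF pow.subspace_image[OF W] U] by simp
qed

lemma power_imageI: "w \<in> W \<Longrightarrow> subspace U \<Longrightarrow> (\<eta> ^^ k) w \<in> power_image k W U"
  unfolding power_image_def using subspace_0 by force

lemma power_imageI2: "u \<in> U \<Longrightarrow> subspace W \<Longrightarrow> u \<in> power_image k W U"
  unfolding power_image_def using subspace_0 by force

lemma power_image_0: "subspace W \<Longrightarrow> subspace U \<Longrightarrow> U \<subseteq> W \<Longrightarrow> power_image 0 W U = W"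
  using power_imageI[of _ W U 0] subspace_add[of W] unfolding power_image_def by auto

lemma eta_power_image:
  "invariant U \<Longrightarrow> x \<in> power_image k W U \<Longrightarrow> \<eta> x \<in> power_image (Suc k) W U"
  unfolding power_image_def by (force simp: eta.add intro: invariant_eta)

lemma power_image_Suc_subset:
  "\<eta> ` W \<subseteq> H \<Longrightarrow> power_image (Suc k) W U \<subseteq> power_image k H U"
  unfolding power_image_def by (auto simp: funpow_swap1)

lemma power_image_mono: "H \<subseteq> W \<Longrightarrow> power_image k H U \<subseteq> power_image k W U"
  unfolding power_image_def by blast

lemma power_image_antimono:
  assumes "invariant W" "k \<le> m"
  shows "power_image m W U \<subseteq> power_image k W U"
  using assms(2)
proof (induction m rule: dec_induct)
  case (step m)
  then show ?case
    using power_image_Suc_subset[of W W m U] assms(1) by (auto simp: invariant_def)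
qed simp

lemma power_image_eventually:
  obtains N where "\<And>k W U. k \<ge> N \<Longrightarrow> subspace W \<Longrightarrow> power_image k W U = U"
proof -
  obtain N where N: "\<And>k x. k \<ge> N \<Longrightarrow> (\<eta> ^^ k) x = 0"
    using pow_eventually_zero by blast
  have "power_image k W U = U" if "k \<ge> N" "subspace W" for k W U
    unfolding power_image_def using subspace_0[OF that(2)] N[OF that(1)] by auto
  then show ?thesis by (rule that)
qed

text \<open>On the one-dimensional quotient \<open>L/U\<close> the map \<eta> is multiplication by a
  scalar, and nilpotency forces a power of that scalar to vanish.\<close>

lemma eta_one_step:
  assumes "invariant U" "invariant L" "U \<subseteq> L" "dim L = Suc (dim U)" "x \<in> L"
  shows "\<eta> x \<in> U"
proof -
  note U = invariant_subspace[OF assms(1)] and L = invariant_subspace[OF assms(2)]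
  obtain v where v: "v \<in> L" "v \<notin> U" "L = span (insert v U)"
    using obtain_complement_vector[OF U L assms(3,4)] .
  obtain k where k: "\<eta> v - k *s v \<in> U"
    using invariant_eta[OF assms(2) v(1)] v(3) mem_span_insert_subspace[OF U] by blast
  have iter: "(\<eta> ^^ m) v - (k ^ m) *s v \<in> U" for m
  proof (induction m)
    case (Suc m)
    have "\<eta> ((\<eta> ^^ m) v - (k ^ m) *s v) + (k ^ m) *s (\<eta> v - k *s v) \<in> U"
      using Suc k U assms(1) by (intro subspace_add subspace_scale invariant_eta)
    then show ?case
      by (simp add: eta.diff eta.scale scale_right_diff_distrib mult.commute)
  qed (simp add: subspace_0[OF U])
  obtain N where "(\<eta> ^^ N) v = 0" using pow_eventually_zero by blast
  then have "(k ^ N) *s v \<in> U"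
    using iter[of N] subspace_neg[OF U] by fastforce
  then have "(inverse (k ^ N) * k ^ N) *s v \<in> U"
    using subspace_scale[OF U, of "(k ^ N) *s v" "inverse (k ^ N)"] by simp
  then have "k ^ N = 0"
    using v(2) left_inverse[of "k ^ N"] scale_one by metis
  then have "k = 0" by simp
  then have \<eta>v: "\<eta> v \<in> U" using k by simp
  obtain b where "x - b *s v \<in> U"
    using assms(5) v(3) mem_span_insert_subspace[OF U] by blast
  then have "\<eta> (x - b *s v) + b *s \<eta> v \<in> U"
    using subspace_add[OF U invariant_eta[OF assms(1)] subspace_scale[OF U \<eta>v]] by blast
  then show ?thesis by (simp add: eta.diff eta.scale)
qed

text \<open>Passing to a hyperplane removes one square, in column \<open>c\<close>. For
  \<open>w\<close> in \<open>W\<close> outside \<open>H\<close>, the space \<eta>^k W + U is spanned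
  by \<eta>^k w and \<eta>^k H + U. Once \<eta>^k w lies in the latter, the same holds for all
  larger exponents, so the dimensions differ exactly up to \<open>c\<close>.\<close>

lemma dim_power_image_hyperplane:
  assumes "invariant U" "invariant H" "invariant W" "U \<subseteq> H" "H \<subseteq> W" "dim W = Suc (dim H)"
  shows "\<exists>c. \<forall>k. dim (power_image k W U) = dim (power_image k H U) + (if k \<le> c then 1 else 0)"
proof -
  note U = invariant_subspace[OF assms(1)] and H = invariant_subspace[OF assms(2)]
    and W = invariant_subspace[OF assms(3)]
  obtain w where w: "w \<in> W" "w \<notin> H" "W = span (insert w H)"
    using obtain_complement_vector[OF H W assms(5,6)] .
  have span: "power_image k W U = span (insert ((\<eta> ^^ k) w) (power_image k H U))" for k
  proof
    show "power_image k W U \<subseteq> span (insert ((\<eta> ^^ k) w) (power_image k H U))"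
    proof
      fix x assume "x \<in> power_image k W U"
      then obtain y u where x: "x = (\<eta> ^^ k) y + u" "y \<in> W" "u \<in> U"
        unfolding power_image_def by blast
      then obtain b where b: "y - b *s w \<in> H"
        using w(3) mem_span_insert_subspace[OF H] by blast
      have "x - b *s (\<eta> ^^ k) w = (\<eta> ^^ k) (y - b *s w) + u"
        by (simp add: x pow.diff pow.scale)
      then show "x \<in> span (insert ((\<eta> ^^ k) w) (power_image k H U))"
        unfolding mem_span_insert_subspace[OF subspace_power_image[OF H U]]
        using b x(3) unfolding power_image_def by blast
    qed
    show "span (insert ((\<eta> ^^ k) w) (power_image k H U)) \<subseteq> power_image k W U"
      using power_imageI[OF w(1) U] power_image_mono[OF assms(5)]
      by (intro span_minimal subspace_power_image[OF W U]) auto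
  qed
  let ?P = "\<lambda>k. (\<eta> ^^ k) w \<notin> power_image k H U"
  obtain N where N: "power_image N W U = U"
    using power_image_eventually W order_refl by metis
  have "\<exists>c. \<forall>k. ?P k \<longleftrightarrow> k \<le> c"
  proof (rule decreasing_predicate_threshold)
    show "?P 0" using w(2) power_image_0[OF H U assms(4)] by simp
    show "\<not> ?P N"
      using power_imageI[OF w(1) U, of N] N power_imageI2[OF _ H] by auto
    show "?P k" if "?P (Suc k)" for k
      using that eta_power_image[OF assms(1)] by auto
  qed
  then obtain c where c: "\<And>k. ?P k \<longleftrightarrow> k \<le> c" by blast
  have "dim (power_image k W U) = dim (power_image k H U) + (if k \<le> c then 1 else 0)" for k
    using c[of k] subspace_power_image[OF H U]
    by (simp add: span[of k] dim_insert span_eq_iff[THEN iffD2])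
  then show ?thesis by blast
qed

text \<open>Dividing out the line spanned by \<open>v\<close> removes one square, in column
  \<open>c\<close>: the dimension grows by one unless \<open>v\<close> already lies in \<eta>^k W +
  U, and these spaces decrease with \<open>k\<close>. The membership clause is kept so that the
  thresholds for two choices of \<open>W\<close> can be compared.\<close>

lemma dim_power_image_line:
  assumes "invariant U" "invariant L" "invariant W" "U \<subseteq> L" "L \<subseteq> W"
    and "v \<in> L" "v \<notin> U" "dim L = Suc (dim U)"
  shows "\<exists>c. (\<forall>k. v \<in> power_image k W U \<longleftrightarrow> k \<le> c) \<and>
    (\<forall>k. dim (power_image k W L) = dim (power_image k W U) + (if k \<le> c then 0 else 1))"
proof -
  note U = invariant_subspace[OF assms(1)] and L = invariant_subspace[OF assms(2)]
    and W = invariant_subspace[OF assms(3)]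
  have Lv: "L = span (insert v U)"
    using subspace_eq_span_insert[OF U L assms(4,8,6,7)] .
  have span: "power_image k W L = span (insert v (power_image k W U))" for k
  proof
    show "power_image k W L \<subseteq> span (insert v (power_image k W U))"
    proof
      fix x assume "x \<in> power_image k W L"
      then obtain y u where x: "x = (\<eta> ^^ k) y + u" "y \<in> W" "u \<in> L"
        unfolding power_image_def by blast
      then obtain b where b: "u - b *s v \<in> U"
        using Lv mem_span_insert_subspace[OF U] by blast
      have "x - b *s v = (\<eta> ^^ k) y + (u - b *s v)"
        by (simp add: x)
      then show "x \<in> span (insert v (power_image k W U))"
        unfolding mem_span_insert_subspace[OF subspace_power_image[OF W U]]
        using b x(2) unfolding power_image_def by blast
    qed
    have "power_image k W U \<subseteq> power_image k W L"
      unfolding power_image_def using assms(4) by blast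
    then show "span (insert v (power_image k W U)) \<subseteq> power_image k W L"
      using power_imageI2[OF assms(6) W]
      by (intro span_minimal subspace_power_image[OF W L]) auto
  qed
  let ?P = "\<lambda>k. v \<in> power_image k W U"
  obtain N where N: "power_image N W U = U"
    using power_image_eventually W order_refl by metis
  have "\<exists>c. \<forall>k. ?P k \<longleftrightarrow> k \<le> c"
  proof (rule decreasing_predicate_threshold)
    show "?P 0" using assms(4-6) power_image_0[OF W U] by auto
    show "\<not> ?P N" using assms(7) N by simp
    show "?P k" if "?P (Suc k)" for k
      using that power_image_antimono[OF assms(3), of k "Suc k" U] by auto
  qed
  then obtain c where c: "\<And>k. ?P k \<longleftrightarrow> k \<le> c" by blast
  have "dim (power_image k W L) = dim (power_image k W U) + (if k \<le> c then 0 else 1)" for k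
    using c[of k] subspace_power_image[OF W U]
    by (simp add: span[of k] dim_insert span_eq_iff[THEN iffD2])
  then show ?thesis using c by blast
qed

end

section \<open>Jordan bases of subquotients\<close>

context nilpotent_endo
begin

text \<open>Existence of the coset coordinates is spanning modulo \<open>U\<close>, and their
  uniqueness is independence modulo \<open>U\<close>.\<close>

lemma jordan_basis_iff:
  assumes "invariant U" "subspace W" "U \<subseteq> W" "is_partition \<kappa>"
  shows "jordan_basis \<eta> W U \<kappa> e \<longleftrightarrow>
    e ` young_diagram \<kappa> \<subseteq> W \<and> W \<subseteq> span (U \<union> e ` young_diagram \<kappa>) \<and>
    independent_mod U (young_diagram \<kappa>) e \<and>
    (\<forall>(i, j)\<in>young_diagram \<kappa>. \<eta> (e (i, j)) - (case j of 0 \<Rightarrow> 0 | Suc k \<Rightarrow> e (i, k)) \<in> U)"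
proof -
  let ?Y = "young_diagram \<kappa>"
  let ?comb = "\<lambda>c. \<Sum>s\<in>?Y. c s *s e s"
  note U = invariant_subspace[OF assms(1)]
  have fin: "finite ?Y" by (rule finite_young_diagram[OF assms(4)])
  have unique: "(\<forall>v\<in>W. \<exists>!c. (\<forall>s. s \<notin> ?Y \<longrightarrow> c s = 0) \<and> v - ?comb c \<in> U) \<longleftrightarrow>
      W \<subseteq> span (U \<union> e ` ?Y) \<and> independent_mod U ?Y e"
  proof (intro iffI conjI)
    assume ex: "\<forall>v\<in>W. \<exists>!c. (\<forall>s. s \<notin> ?Y \<longrightarrow> c s = 0) \<and> v - ?comb c \<in> U"
    then show "W \<subseteq> span (U \<union> e ` ?Y)"
      unfolding subset_iff mem_span_Un_iff[OF U fin] by blast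
    show "independent_mod U ?Y e"
      unfolding independent_mod_def
    proof (intro allI impI)
      fix c assume c: "?comb c \<in> U"
      \<comment> \<open>Coefficients off the diagram are cut off, since uniqueness is asserted only
        among functions that vanish there.\<close>
      let ?c = "\<lambda>s. if s \<in> ?Y then c s else 0"
      have "?comb ?c = ?comb c" by (intro sum.cong) auto
      then have 1: "(\<forall>s. s \<notin> ?Y \<longrightarrow> ?c s = 0) \<and> 0 - ?comb ?c \<in> U"
        using c subspace_neg[OF U] by simp
      have 2: "(\<forall>s. s \<notin> ?Y \<longrightarrow> (\<lambda>_. 0) s = 0) \<and> 0 - ?comb (\<lambda>_. 0) \<in> U"
        using subspace_0[OF U] by simp
      have "\<exists>!c. (\<forall>s. s \<notin> ?Y \<longrightarrow> c s = 0) \<and> 0 - ?comb c \<in> U"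
        using ex assms(2) subspace_0 by blast
      then obtain d where d: "\<And>c. (\<forall>s. s \<notin> ?Y \<longrightarrow> c s = 0) \<and> 0 - ?comb c \<in> U \<Longrightarrow> c = d"
        by (elim ex1E) blast
      have "?c = (\<lambda>_. 0)" using d[OF 1] d[OF 2] by simp
      then have "?c s = 0" for s by (rule fun_cong)
      then show "\<forall>s\<in>?Y. c s = 0" by (metis (full_types))
    qed
  next
    assume asm: "W \<subseteq> span (U \<union> e ` ?Y) \<and> independent_mod U ?Y e"
    show "\<forall>v\<in>W. \<exists>!c. (\<forall>s. s \<notin> ?Y \<longrightarrow> c s = 0) \<and> v - ?comb c \<in> U"
    proof
      fix v assume "v \<in> W"
      then obtain c where c: "v - ?comb c \<in> U"
        using asm mem_span_Un_iff[OF U fin] by blast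
      let ?c = "\<lambda>s. if s \<in> ?Y then c s else 0"
      have "?comb ?c = ?comb c" by (intro sum.cong) auto
      then have ex: "(\<forall>s. s \<notin> ?Y \<longrightarrow> ?c s = 0) \<and> v - ?comb ?c \<in> U"
        using c by simp
      show "\<exists>!c. (\<forall>s. s \<notin> ?Y \<longrightarrow> c s = 0) \<and> v - ?comb c \<in> U"
      proof (rule ex1I[of _ ?c])
        show "(\<forall>s. s \<notin> ?Y \<longrightarrow> ?c s = 0) \<and> v - ?comb ?c \<in> U" by (rule ex)
        fix d assume d: "(\<forall>s. s \<notin> ?Y \<longrightarrow> d s = 0) \<and> v - ?comb d \<in> U"
        have "(v - ?comb ?c) - (v - ?comb d) \<in> U"
          by (rule subspace_diff[OF U ex[THEN conjunct2] d[THEN conjunct2]])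
        then have "?comb (\<lambda>s. d s - ?c s) \<in> U"
          by (simp add: scale_left_diff_distrib sum_subtractf algebra_simps)
        then have "\<forall>s\<in>?Y. d s - ?c s = 0"
          by (rule asm[THEN conjunct2, unfolded independent_mod_def, rule_format, THEN ballI])
        then have "d s = ?c s" for s
          using d[THEN conjunct1, rule_format, of s] by (cases "s \<in> ?Y") simp_all
        then show "d = ?c" by (rule ext)
      qed
    qed
  qed
  show ?thesis
    unfolding jordan_basis_def coset_eq_iff[OF U] unique
      induced_coset[OF U linear_eta assms(1)[unfolded invariant_def, THEN conjunct2]]
    by auto
qed

text \<open>Each application of \<eta> moves one square towards column 0 within its row; beyond
  column 0 the vector falls into \<open>U\<close>.\<close>

lemma pow_jordan_basis:
  assumes "invariant U"
    and "\<forall>(i, j)\<in>young_diagram \<kappa>. \<eta> (e (i, j)) - (case j of 0 \<Rightarrow> 0 | Suc k \<Rightarrow> e (i, k)) \<in> U"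
    and "(i, j) \<in> young_diagram \<kappa>"
  shows "(\<eta> ^^ k) (e (i, j)) - (if k \<le> j then e (i, j - k) else 0) \<in> U"
proof (induction k)
  case 0
  then show ?case using subspace_0[OF invariant_subspace[OF assms(1)]] by simp
next
  case (Suc k)
  note U = invariant_subspace[OF assms(1)]
  let ?x = "if k \<le> j then e (i, j - k) else 0"
  have 1: "\<eta> ((\<eta> ^^ k) (e (i, j)) - ?x) \<in> U"
    by (rule invariant_eta[OF assms(1) Suc])
  have 2: "\<eta> ?x - (if Suc k \<le> j then e (i, j - Suc k) else 0) \<in> U"
  proof (cases "k \<le> j")
    case True
    then have "(i, j - k) \<in> young_diagram \<kappa>"
      using assms(3) by (auto simp: young_diagram_def)
    then have "\<eta> (e (i, j - k)) - (case j - k of 0 \<Rightarrow> 0 | Suc k \<Rightarrow> e (i, k)) \<in> U"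
      using assms(2) by blast
    moreover have "(case j - k of 0 \<Rightarrow> 0 | Suc k \<Rightarrow> e (i, k)) =
        (if Suc k \<le> j then e (i, j - Suc k) else 0)"
      using True by (auto split: nat.splits intro!: arg_cong[of _ _ e])
    ultimately show ?thesis using True by simp
  next
    case False
    then show ?thesis using subspace_0[OF U] by simp
  qed
  show ?case using subspace_add[OF U 1 2] by (simp add: eta.diff)
qed

lemma power_image_jordan_basis:
  assumes "invariant U" "subspace W" "U \<subseteq> W" "is_partition \<kappa>" "jordan_basis \<eta> W U \<kappa> e"
  shows "power_image k W U = span (U \<union> e ` diagram_from \<kappa> k)"
proof
  note U = invariant_subspace[OF assms(1)]
  note sub = subspace_power_image[OF assms(2) U, of k]
  note J = assms(5)[unfolded jordan_basis_iff[OF assms(1-4)]]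
  have fin: "finite (young_diagram \<kappa>)" by (rule finite_young_diagram[OF assms(4)])
  let ?T = "span (U \<union> e ` diagram_from \<kappa> k)"
  have T: "(\<eta> ^^ k) (e s) \<in> ?T" if s: "s \<in> young_diagram \<kappa>" for s
  proof -
    obtain i j where ij: "s = (i, j)" by fastforce
    have 1: "(\<eta> ^^ k) (e s) - (if k \<le> j then e (i, j - k) else 0) \<in> U"
      using pow_jordan_basis[OF assms(1), of \<kappa> e i j k] J s unfolding ij by blast
    have 2: "(if k \<le> j then e (i, j - k) else 0) \<in> ?T"
    proof (cases "k \<le> j")
      case True
      then have "(i, j - k) \<in> diagram_from \<kappa> k"
        using s unfolding ij young_diagram_def diagram_from_def by auto
      then show ?thesis using True by (auto intro: span_base)
    qed (simp add: span_zero)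
    show ?thesis using span_add[OF span_base[OF UnI1[OF 1]] 2] by simp
  qed
  show "power_image k W U \<subseteq> ?T"
  proof
    fix x assume "x \<in> power_image k W U"
    then obtain w u where x: "x = (\<eta> ^^ k) w + u" "w \<in> W" "u \<in> U"
      unfolding power_image_def by blast
    have "w \<in> span (U \<union> e ` young_diagram \<kappa>)" using J x(2) by blast
    then obtain c where c: "w - (\<Sum>s\<in>young_diagram \<kappa>. c s *s e s) \<in> U"
      unfolding mem_span_Un_iff[OF U fin] by blast
    have "(\<eta> ^^ k) (w - (\<Sum>s\<in>young_diagram \<kappa>. c s *s e s)) \<in> ?T"
      using invariant_pow[OF assms(1) c] by (auto intro: span_base)
    moreover have "(\<Sum>s\<in>young_diagram \<kappa>. c s *s (\<eta> ^^ k) (e s)) \<in> ?T"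
      using T by (intro span_sum span_scale)
    moreover have "u \<in> ?T" using x(3) by (auto intro: span_base)
    ultimately have "(\<eta> ^^ k) (w - (\<Sum>s\<in>young_diagram \<kappa>. c s *s e s)) +
        (\<Sum>s\<in>young_diagram \<kappa>. c s *s (\<eta> ^^ k) (e s)) + u \<in> ?T"
      by (intro span_add)
    then show "x \<in> ?T" by (simp add: x(1) pow.diff pow.sum pow.scale)
  qed
  have "e s \<in> power_image k W U" if s: "s \<in> diagram_from \<kappa> k" for s
  proof -
    obtain i j where ij: "s = (i, j)" by fastforce
    have Y: "(i, j + k) \<in> young_diagram \<kappa>"
      using s unfolding ij young_diagram_def diagram_from_def by auto
    have "(\<eta> ^^ k) (e (i, j + k)) - (if k \<le> j + k then e (i, j + k - k) else 0) \<in> U"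
      using pow_jordan_basis[OF assms(1), of \<kappa> e i "j + k" k] J Y by blast
    then have 1: "(\<eta> ^^ k) (e (i, j + k)) - e (i, j) \<in> U" by simp
    have "(\<eta> ^^ k) (e (i, j + k)) \<in> power_image k W U"
      using J Y by (intro power_imageI U) blast
    from subspace_diff[OF sub this power_imageI2[OF 1 assms(2)]]
    show ?thesis by (simp add: ij)
  qed
  then show "?T \<subseteq> power_image k W U"
    using power_imageI2[OF _ assms(2)] by (intro span_minimal sub) auto
qed

lemma dim_power_image_jordan_basis:
  assumes "invariant U" "subspace W" "U \<subseteq> W" "is_partition \<kappa>" "jordan_basis \<eta> W U \<kappa> e"
  shows "dim (power_image k W U) = dim U + card (diagram_from \<kappa> k)"
proof -
  have fin: "finite (young_diagram \<kappa>)" by (rule finite_young_diagram[OF assms(4)])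
  have "independent_mod U (diagram_from \<kappa> k) e"
    using assms(5) fin diagram_from_subset unfolding jordan_basis_iff[OF assms(1-4)]
    by (blast intro: independent_mod_subset)
  then show ?thesis
    unfolding power_image_jordan_basis[OF assms]
    using finite_subset[OF diagram_from_subset fin]
    by (intro dim_span_Un_independent_mod invariant_subspace assms(1))
qed

text \<open>The drop in rank from the \<open>k\<close>-th to the next power counts the Jordan blocks
  larger than \<open>k\<close>. As the dimensions do not mention the basis, this gives uniqueness of
  the Jordan type.\<close>

lemma column_length_jordan_basis:
  assumes "invariant U" "subspace W" "U \<subseteq> W" "is_partition \<kappa>" "jordan_basis \<eta> W U \<kappa> e"
  shows "dim (power_image k W U) = column_length \<kappa> k + dim (power_image (Suc k) W U)"
  unfolding dim_power_image_jordan_basis[OF assms] using card_diagram_from[OF assms(4), of k]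
  by simp

text \<open>A functional that vanishes on \<open>U\<close> but not on the end of a longest chain cuts out an
  invariant complement of that chain modulo \<open>U\<close>.\<close>

lemma jordan_basis_exists_bounded:
  assumes "invariant U" "invariant W" "U \<subseteq> W" "\<forall>x\<in>W. (\<eta> ^^ m) x \<in> U"
  shows "\<exists>\<kappa> e. is_partition \<kappa> \<and> (\<forall>i. \<kappa> i \<le> m) \<and> jordan_basis \<eta> W U \<kappa> e"
  using assms
\<comment> \<open>The bound on row lengths is carried along so that a chain of maximal length
  \<open>q\<close> can be put in as row 0: the hypothesis, used with \<open>q\<close> for
  \<open>m\<close>, makes all other rows at most that long.\<close>
proof (induction "dim W" arbitrary: W m rule: less_induct)
  case less
  note U = invariant_subspace[OF less.prems(1)] and W = invariant_subspace[OF less.prems(2)]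
  show ?case
  proof (cases "W = U")
    case True
    have part: "is_partition (\<lambda>_. 0)" by (simp add: is_partition_def antimono_def)
    have "jordan_basis \<eta> W U (\<lambda>_. 0) (\<lambda>_. 0)"
      unfolding jordan_basis_iff[OF less.prems(1) W less.prems(3) part]
      using True by (auto simp: young_diagram_def independent_mod_def intro: span_base)
    then show ?thesis using part by blast
  next
    case False
    \<comment> \<open>The nilpotency index on \<open>W/U\<close>, hence the length of a longest
      chain. It is positive because \<open>W\<close> differs from \<open>U\<close>.\<close>
    define q where "q = (LEAST q. \<forall>x\<in>W. (\<eta> ^^ q) x \<in> U)"
    have q: "\<forall>x\<in>W. (\<eta> ^^ q) x \<in> U"
      unfolding q_def by (rule LeastI[of _ m]) (rule less.prems(4))
    have "q \<le> m" unfolding q_def by (rule Least_le) (rule less.prems(4))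
    have "q \<noteq> 0" using q False less.prems(3) by (auto dest: bspec)
    then obtain p where p: "q = Suc p" using not0_implies_Suc by blast
    have "\<not> (\<forall>x\<in>W. (\<eta> ^^ p) x \<in> U)"
      using not_less_Least[of p "\<lambda>q. \<forall>x\<in>W. (\<eta> ^^ q) x \<in> U"] p unfolding q_def by simp
    then obtain v where v: "v \<in> W" "(\<eta> ^^ p) v \<notin> U" by blast
    obtain \<phi> where \<phi>: "Vector_Spaces.linear scale (*) \<phi>" "\<And>x. x \<in> U \<Longrightarrow> \<phi> x = 0"
        "\<phi> ((\<eta> ^^ p) v) = 1"
      using exists_functional[OF U v(2)] by blast
    interpret \<phi>: Vector_Spaces.linear scale "(*)" \<phi> by (rule \<phi>(1))
    have high: "(\<eta> ^^ k) x \<in> U" if "x \<in> W" "k > p" for x k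
      using pow_mono_mem[OF less.prems(1), of q x k] q that p by auto
    \<comment> \<open>The largest \<eta>-invariant subspace of \<open>W\<close> on which
      \<open>\<phi>\<close> vanishes. It contains \<open>U\<close> and complements the chain of
      \<open>v\<close> modulo \<open>U\<close>.\<close>
    define W' where "W' = {x \<in> W. \<forall>k. \<phi> ((\<eta> ^^ k) x) = 0}"
    have sub': "subspace W'"
      unfolding subspace_def W'_def
      using W by (auto simp: subspace_0 subspace_add subspace_scale pow.add pow.scale pow.zero
          \<phi>.zero \<phi>.add \<phi>.scale)
    have inv': "invariant W'"
      unfolding invariant_def
    proof (intro conjI sub' image_subsetI)
      fix x assume "x \<in> W'"
      then have x: "x \<in> W" "\<And>k. \<phi> ((\<eta> ^^ k) x) = 0" by (auto simp: W'_def)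
      have "\<phi> ((\<eta> ^^ k) (\<eta> x)) = 0" for k
        using x(2)[of "Suc k"] by (simp add: funpow_swap1)
      then show "\<eta> x \<in> W'"
        using invariant_eta[OF less.prems(2) x(1)] by (simp add: W'_def)
    qed
    have U': "U \<subseteq> W'"
      unfolding W'_def using less.prems(3) invariant_pow[OF less.prems(1)] \<phi>(2) by auto
    have "(\<eta> ^^ p) v \<in> W" "(\<eta> ^^ p) v \<notin> W'"
      using invariant_pow[OF less.prems(2) v(1)] \<phi>(3) by (auto simp: W'_def intro!: exI[of _ 0])
    then have "W' \<subset> W" unfolding W'_def by blast
    then have "dim W' < dim W"
      using dim_psubset[of W' W] sub' W by (simp add: span_eq_iff[THEN iffD2])
    moreover have "\<forall>x\<in>W'. (\<eta> ^^ q) x \<in> U" using q by (simp add: W'_def)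
    ultimately obtain \<kappa>' e' where part': "is_partition \<kappa>'" and bound': "\<And>i. \<kappa>' i \<le> q"
      and "jordan_basis \<eta> W' U \<kappa>' e'"
      using less.hyps[OF _ less.prems(1) inv' U'] by blast
    note J' = this(3)[unfolded jordan_basis_iff[OF less.prems(1) sub' U' part']]
    define \<kappa> where "\<kappa> i = (case i of 0 \<Rightarrow> q | Suc i \<Rightarrow> \<kappa>' i)" for i
    \<comment> \<open>The exponent is reversed because column 0 must hold the end of the
      chain.\<close>
    define e where "e s = (case fst s of 0 \<Rightarrow> (\<eta> ^^ (p - snd s)) v | Suc i \<Rightarrow> e' (i, snd s))" for s
    have e_simps: "e (0, j) = (\<eta> ^^ (p - j)) v" "e (Suc i, j) = e' (i, j)" for i j
      by (simp_all add: e_def)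
    have part: "is_partition \<kappa>"
      unfolding is_partition_def
    proof
      show "antimono \<kappa>"
        using part' bound' unfolding is_partition_def \<kappa>_def
        by (auto simp: antimono_iff_le_Suc split: nat.splits)
      have "{i. \<kappa> i \<noteq> 0} \<subseteq> insert 0 (Suc ` {i. \<kappa>' i \<noteq> 0})"
      proof
        fix i assume "i \<in> {i. \<kappa> i \<noteq> 0}"
        then show "i \<in> insert 0 (Suc ` {i. \<kappa>' i \<noteq> 0})"
          by (cases i) (auto simp: \<kappa>_def)
      qed
      then show "finite {i. \<kappa> i \<noteq> 0}"
        using part' unfolding is_partition_def by (auto intro: finite_subset)
    qed
    have Y: "young_diagram \<kappa> = Pair 0 ` {..p} \<union> apfst Suc ` young_diagram \<kappa>'"
    proof -
      have "(i, j) \<in> young_diagram \<kappa> \<longleftrightarrow> (i, j) \<in> Pair 0 ` {..p} \<union> apfst Suc ` young_diagram \<kappa>'" for i j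
        by (cases i) (auto simp: young_diagram_def \<kappa>_def p image_iff)
      then show ?thesis by auto
    qed
    have fin': "finite (young_diagram \<kappa>')" by (rule finite_young_diagram[OF part'])
    have sumY: "(\<Sum>s\<in>young_diagram \<kappa>. c s *s e s) =
        (\<Sum>j\<le>p. c (0, j) *s (\<eta> ^^ (p - j)) v) +
        (\<Sum>s\<in>young_diagram \<kappa>'. c (apfst Suc s) *s e' s)" for c
    proof -
      have "(\<Sum>s\<in>young_diagram \<kappa>. c s *s e s) = (\<Sum>s\<in>Pair 0 ` {..p}. c s *s e s) +
          (\<Sum>s\<in>apfst Suc ` young_diagram \<kappa>'. c s *s e s)"
        unfolding Y using fin' by (intro sum.union_disjoint) auto
      also have "(\<Sum>s\<in>Pair 0 ` {..p}. c s *s e s) = (\<Sum>j\<le>p. c (0, j) *s (\<eta> ^^ (p - j)) v)"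
        by (subst sum.reindex) (auto simp: inj_on_def e_simps)
      also have "(\<Sum>s\<in>apfst Suc ` young_diagram \<kappa>'. c s *s e s) =
          (\<Sum>s\<in>young_diagram \<kappa>'. c (apfst Suc s) *s e' s)"
        by (subst sum.reindex) (auto simp: inj_on_def e_def intro!: sum.cong)
      finally show ?thesis .
    qed
    have in_W: "e ` young_diagram \<kappa> \<subseteq> W"
      using J' invariant_pow[OF less.prems(2) v(1)] unfolding Y W'_def
      by (auto simp: e_simps)
    have spanning: "W \<subseteq> span (U \<union> e ` young_diagram \<kappa>)"
    proof
      fix x assume x: "x \<in> W"
      have v_in: "(\<eta> ^^ j) v \<in> span (U \<union> e ` young_diagram \<kappa>)" if "j \<le> p" for j
      proof -
        have "(\<eta> ^^ j) v = e (0, p - j)" "(0, p - j) \<in> young_diagram \<kappa>"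
          using that by (auto simp: e_simps Y)
        then show ?thesis by (auto intro: span_base)
      qed
      \<comment> \<open>Triangular elimination: subtracting a multiple of \<eta>^k v cures the
        condition at \<open>j = k\<close>. It keeps those at \<open>j < k\<close>, where the
        exponent \<open>p - j + k\<close> exceeds \<open>p\<close>.\<close>
      have "\<exists>y\<in>W. x - y \<in> span (U \<union> e ` young_diagram \<kappa>) \<and> (\<forall>j<k. \<phi> ((\<eta> ^^ (p - j)) y) = 0)"
        if "k \<le> Suc p" for k
        using that
      proof (induction k)
        case 0
        then show ?case using x by (intro bexI[of _ x]) (auto simp: span_zero)
      next
        case (Suc k)
        then obtain y where y: "y \<in> W" "x - y \<in> span (U \<union> e ` young_diagram \<kappa>)"
            "\<And>j. j < k \<Longrightarrow> \<phi> ((\<eta> ^^ (p - j)) y) = 0"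
          by auto
        let ?b = "\<phi> ((\<eta> ^^ (p - k)) y)"
        let ?z = "y - ?b *s (\<eta> ^^ k) v"
        have z: "?z \<in> W"
          using y(1) invariant_pow[OF less.prems(2) v(1)] W
          by (intro subspace_diff subspace_scale)
        have "x - ?z = (x - y) + ?b *s (\<eta> ^^ k) v" by simp
        moreover have "(x - y) + ?b *s (\<eta> ^^ k) v \<in> span (U \<union> e ` young_diagram \<kappa>)"
          using y(2) v_in[of k] Suc.prems by (intro span_add span_scale) auto
        ultimately have xz: "x - ?z \<in> span (U \<union> e ` young_diagram \<kappa>)" by (simp only:)
        have "\<phi> ((\<eta> ^^ (p - j)) ?z) = 0" if "j < Suc k" for j
        proof -
          have *: "\<phi> ((\<eta> ^^ (p - j)) ?z) = \<phi> ((\<eta> ^^ (p - j)) y) - ?b * \<phi> ((\<eta> ^^ (p - j + k)) v)"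
            by (simp add: pow.diff pow.scale \<phi>.diff \<phi>.scale funpow_add)
          show ?thesis
          proof (cases "j = k")
            case True
            then show ?thesis using * Suc.prems \<phi>(3) by simp
          next
            case False
            then have "p - j + k > p" using that Suc.prems by simp
            then show ?thesis using * y(3)[of j] False that high[OF v(1)] \<phi>(2) by simp
          qed
        qed
        then show ?case using z xz by blast
      qed
      from this[of "Suc p"] obtain y where y: "y \<in> W" "x - y \<in> span (U \<union> e ` young_diagram \<kappa>)"
          "\<And>j. j < Suc p \<Longrightarrow> \<phi> ((\<eta> ^^ (p - j)) y) = 0" by auto
      have "\<phi> ((\<eta> ^^ k) y) = 0" for k
        using y(3)[of "p - k"] high[OF y(1), of k] \<phi>(2) by (cases "k \<le> p") auto
      then have "y \<in> W'" using y(1) by (simp add: W'_def)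
      then have "y \<in> span (U \<union> e' ` young_diagram \<kappa>')" using J' by blast
      moreover have "e' ` young_diagram \<kappa>' \<subseteq> e ` young_diagram \<kappa>"
      proof
        fix z assume "z \<in> e' ` young_diagram \<kappa>'"
        then obtain i j where "z = e' (i, j)" "(i, j) \<in> young_diagram \<kappa>'" by auto
        then have "z = e (Suc i, j)" "(Suc i, j) \<in> young_diagram \<kappa>"
          by (auto simp: e_simps young_diagram_def \<kappa>_def)
        then show "z \<in> e ` young_diagram \<kappa>" by blast
      qed
      ultimately have "y \<in> span (U \<union> e ` young_diagram \<kappa>)"
        using span_mono[of "U \<union> e' ` young_diagram \<kappa>'" "U \<union> e ` young_diagram \<kappa>"] by blast
      from span_add[OF y(2) this] show "x \<in> span (U \<union> e ` young_diagram \<kappa>)" by simp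
    qed
    have ind: "independent_mod U (young_diagram \<kappa>) e"
      unfolding independent_mod_def
    proof (intro allI impI)
      fix c assume c: "(\<Sum>s\<in>young_diagram \<kappa>. c s *s e s) \<in> U"
      let ?z = "\<Sum>j\<le>p. c (0, j) *s (\<eta> ^^ (p - j)) v"
      let ?y = "\<Sum>s\<in>young_diagram \<kappa>'. c (apfst Suc s) *s e' s"
      have "?y \<in> W'" using J' by (intro subspace_sum[OF sub'] subspace_scale[OF sub']) auto
      moreover have "?z + ?y \<in> W'" using c U' unfolding sumY by blast
      ultimately have z: "?z \<in> W'" using subspace_diff[OF sub'] by fastforce
      have zero: "\<forall>j\<le>p. c (0, j) = 0"
      proof (rule ccontr)
        assume "\<not> (\<forall>j\<le>p. c (0, j) = 0)"
        then have ne: "{j. j \<le> p \<and> c (0, j) \<noteq> 0} \<noteq> {}" by auto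
        \<comment> \<open>Applying \<eta>^t and then \<open>\<phi>\<close> isolates the coefficient
          at \<open>t\<close>: larger indices have coefficient zero, and smaller ones get an
          exponent above \<open>p\<close>.\<close>
        define t where "t = Max {j. j \<le> p \<and> c (0, j) \<noteq> 0}"
        have t: "t \<le> p" "c (0, t) \<noteq> 0"
          using Max_in[OF _ ne] unfolding t_def by auto
        have above: "c (0, j) = 0" if "j \<le> p" "j > t" for j
        proof (rule ccontr)
          assume "c (0, j) \<noteq> 0"
          then have "j \<le> t" unfolding t_def using that by (intro Max_ge) auto
          then show False using that by simp
        qed
        have "\<phi> ((\<eta> ^^ t) ?z) = (\<Sum>j\<le>p. c (0, j) * \<phi> ((\<eta> ^^ (t + (p - j))) v))"
          by (simp add: pow.sum pow.scale \<phi>.sum \<phi>.scale funpow_add del: add_diff_assoc)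
        also have "\<dots> = (\<Sum>j\<le>p. if j = t then c (0, t) else 0)"
        proof (rule sum.cong)
          fix j assume j: "j \<in> {..p}"
          show "c (0, j) * \<phi> ((\<eta> ^^ (t + (p - j))) v) = (if j = t then c (0, t) else 0)"
          proof (cases j t rule: linorder_cases)
            case less
            then have "t + (p - j) > p" using j by auto
            then show ?thesis using high[OF v(1)] \<phi>(2) less by simp
          next
            case equal
            then show ?thesis using t(1) \<phi>(3) by simp
          next
            case greater
            then show ?thesis using above[of j] j by simp
          qed
        qed simp
        also have "\<dots> = c (0, t)" using t(1) by simp
        finally show False using z t(2) by (auto simp: W'_def)
      qed
      then have "?z = 0" by (intro sum.neutral) auto
      then have "?y \<in> U" using c unfolding sumY by simp
      then have "\<forall>s\<in>young_diagram \<kappa>'. c (apfst Suc s) = 0"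
        by (rule J'[THEN conjunct2, THEN conjunct2, THEN conjunct1, unfolded independent_mod_def,
              rule_format, THEN ballI])
      then show "\<forall>s\<in>young_diagram \<kappa>. c s = 0"
        unfolding Y using zero by auto
    qed
    have chains: "\<forall>(i, j)\<in>young_diagram \<kappa>.
        \<eta> (e (i, j)) - (case j of 0 \<Rightarrow> 0 | Suc k \<Rightarrow> e (i, k)) \<in> U"
    proof (intro ballI, clarify)
      fix i j assume ij: "(i, j) \<in> young_diagram \<kappa>"
      show "\<eta> (e (i, j)) - (case j of 0 \<Rightarrow> 0 | Suc k \<Rightarrow> e (i, k)) \<in> U"
      proof (cases i)
        case 0
        then have "j \<le> p" using ij by (simp add: young_diagram_def \<kappa>_def p)
        show ?thesis
        proof (cases j)
          case 0
          then show ?thesis using \<open>i = 0\<close> high[OF v(1), of "Suc p"] by (simp add: e_simps)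
        next
          case (Suc k)
          then have "p - k = Suc (p - j)" using \<open>j \<le> p\<close> by simp
          then show ?thesis using \<open>i = 0\<close> Suc subspace_0[OF U] by (simp add: e_simps)
        qed
      next
        case (Suc i')
        then have "(i', j) \<in> young_diagram \<kappa>'" using ij by (simp add: young_diagram_def \<kappa>_def)
        then have "\<eta> (e' (i', j)) - (case j of 0 \<Rightarrow> 0 | Suc k \<Rightarrow> e' (i', k)) \<in> U"
          using J' by blast
        then show ?thesis unfolding Suc by (cases j) (simp_all add: e_simps)
      qed
    qed
    have "jordan_basis \<eta> W U \<kappa> e"
      unfolding jordan_basis_iff[OF less.prems(1) W less.prems(3) part]
      using in_W spanning ind chains by blast
    moreover have "\<kappa> i \<le> m" for i
      using bound' \<open>q \<le> m\<close> by (auto simp: \<kappa>_def intro: order_trans split: nat.splits)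
    ultimately show ?thesis using part by blast
  qed
qed

text \<open>Makes the definite description in \<open>jordan_type\<close> meaningful: a nilpotency
  exponent of \<eta> serves as the bound for existence, and equal column lengths give
  uniqueness.\<close>

lemma jordan_type_basis:
  assumes "invariant U" "invariant W" "U \<subseteq> W"
  shows "is_partition (jordan_type \<eta> W U)" "\<exists>e. jordan_basis \<eta> W U (jordan_type \<eta> W U) e"
proof -
  note W = invariant_subspace[OF assms(2)]
  obtain N where "\<And>x. (\<eta> ^^ N) x = 0" using pow_eventually_zero by blast
  then have "\<forall>x\<in>W. (\<eta> ^^ N) x \<in> U"
    using subspace_0[OF invariant_subspace[OF assms(1)]] by simp
  then have ex: "\<exists>\<kappa>. is_partition \<kappa> \<and> (\<exists>e. jordan_basis \<eta> W U \<kappa> e)"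
    using jordan_basis_exists_bounded[OF assms] by blast
  have "\<kappa> = \<mu>" if "is_partition \<kappa> \<and> (\<exists>e. jordan_basis \<eta> W U \<kappa> e)"
    "is_partition \<mu> \<and> (\<exists>e. jordan_basis \<eta> W U \<mu> e)" for \<kappa> \<mu>
  proof (rule partition_eqI)
    fix k
    show "column_length \<kappa> k = column_length \<mu> k"
      using column_length_jordan_basis[OF assms(1) W assms(3), of \<kappa> _ k]
        column_length_jordan_basis[OF assms(1) W assms(3), of \<mu> _ k] that
      by (metis add_right_cancel)
  qed (use that in auto)
  with ex have "\<exists>!\<kappa>. is_partition \<kappa> \<and> (\<exists>e. jordan_basis \<eta> W U \<kappa> e)" by blast
  from theI'[OF this] show "is_partition (jordan_type \<eta> W U)"
    "\<exists>e. jordan_basis \<eta> W U (jordan_type \<eta> W U) e"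
    unfolding jordan_type_def by blast+
qed

lemma column_length_jordan_type:
  assumes "invariant U" "invariant W" "U \<subseteq> W"
  shows "dim (power_image k W U) =
    column_length (jordan_type \<eta> W U) k + dim (power_image (Suc k) W U)"
  using jordan_type_basis[OF assms]
    column_length_jordan_basis[OF assms(1) invariant_subspace[OF assms(2)] assms(3)]
  by blast

end

section \<open>Pluecker coordinates\<close>

context finite_dimensional_vector_space
begin

text \<open>A vanishing minor means a nonzero kernel vector of the transposed matrix, that is, a
  nontrivial combination of the rows that is zero in all columns of \<open>I\<close>.\<close>

lemma plucker_eq_0_iff:
  assumes "length I = d"
  shows "plucker vs I = 0 \<longleftrightarrow> (\<exists>c. (\<exists>r<d. c r \<noteq> 0) \<and>
    (\<forall>q<d. representation Basis (\<Sum>r<d. c r *s vs ! r) (I ! q) = 0))"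
proof -
  let ?M = "mat d d (\<lambda>(r, q). representation Basis (vs ! r) (I ! q))"
  have M: "?M \<in> carrier_mat d d" by simp
  have rep: "representation Basis (\<Sum>r<d. c r *s vs ! r) b =
      (\<Sum>r<d. c r * representation Basis (vs ! r) b)" for c b
    by (simp add: representation_sum[OF independent_Basis]
        representation_scale[OF independent_Basis] span_Basis)
  have prod: "(?M\<^sup>T *\<^sub>v v = 0\<^sub>v d) \<longleftrightarrow>
      (\<forall>q<d. representation Basis (\<Sum>r<d. (v $ r) *s vs ! r) (I ! q) = 0)"
    if "v \<in> carrier_vec d" for v
    using that unfolding rep vec_eq_iff
    by (auto simp: scalar_prod_def atLeast0LessThan mult.commute)
  have "plucker vs I = 0 \<longleftrightarrow> det ?M\<^sup>T = 0"
    unfolding plucker_def assms det_transpose[OF M] ..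
  also have "\<dots> \<longleftrightarrow> (\<exists>v. v \<in> carrier_vec d \<and> v \<noteq> 0\<^sub>v d \<and> ?M\<^sup>T *\<^sub>v v = 0\<^sub>v d)"
    by (rule det_0_iff_vec_prod_zero) simp
  also have "\<dots> \<longleftrightarrow> (\<exists>c. (\<exists>r<d. c r \<noteq> 0) \<and>
    (\<forall>q<d. representation Basis (\<Sum>r<d. c r *s vs ! r) (I ! q) = 0))" (is "?L \<longleftrightarrow> ?R")
  proof
    assume ?L
    then obtain v where v: "v \<in> carrier_vec d" "v \<noteq> 0\<^sub>v d" "?M\<^sup>T *\<^sub>v v = 0\<^sub>v d" by blast
    have "\<exists>r<d. v $ r \<noteq> 0" using v(1,2) by (auto simp: vec_eq_iff)
    then show ?R using v(3) prod[OF v(1)] by (intro exI[of _ "\<lambda>r. v $ r"]) blast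
  next
    assume ?R
    then obtain c where c: "\<exists>r<d. c r \<noteq> 0"
      "\<forall>q<d. representation Basis (\<Sum>r<d. c r *s vs ! r) (I ! q) = 0" by blast
    have "vec d c \<noteq> 0\<^sub>v d" using c(1) by (auto simp: vec_eq_iff)
    moreover have "?M\<^sup>T *\<^sub>v vec d c = 0\<^sub>v d"
      using c(2) by (subst prod) auto
    ultimately show ?L by (intro exI[of _ "vec d c"]) auto
  qed
  finally show ?thesis .
qed

lemma plucker_dependent:
  assumes "length I = length vs" "dim (span (set vs)) < length vs"
  shows "plucker vs I = 0"
proof -
  let ?d = "length vs"
  obtain b where b: "b \<subseteq> span (set vs)" "independent b" "span (set vs) \<subseteq> span b"
      "card b = dim (span (set vs))"
    using basis_exists .
  obtain ws where ws: "set ws = b" "distinct ws"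
    using finite_distinct_list[OF finiteI_independent[OF b(2)]] by blast
  \<comment> \<open>A basis of the span is too short; padding it in front with zero vectors gives a
    list of the right length whose matrix has a zero row at index 0.\<close>
  define us where "us = replicate (?d - length ws) 0 @ ws"
  have len: "length ws < ?d" using b(4) ws assms(2) distinct_card by metis
  then have us: "length us = ?d" "us ! 0 = 0" by (simp_all add: us_def nth_append)
  have "span (set vs) \<subseteq> span (set us)"
    using b(3) ws(1) span_mono[of b "set us"] by (auto simp: us_def)
  then obtain a where a: "\<And>I. length I = length us \<Longrightarrow> plucker vs I = a * plucker us I"
    using plucker_change_basis[of vs us] us(1) by metis
  let ?c = "\<lambda>r::nat. if r = 0 then 1 else (0::'a)"
  have "(\<Sum>r<?d. ?c r *s us ! r) = 0"
    using us(2) by (intro sum.neutral) auto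
  moreover have "\<exists>r<?d. ?c r \<noteq> 0" using len by (intro exI[of _ 0]) auto
  ultimately have "plucker us I = 0"
    unfolding plucker_eq_0_iff[OF assms(1)]
    by (intro exI[of _ ?c]) (simp add: representation_zero)
  then show ?thesis using a assms(1) us(1) by simp
qed

lemma sum_representation_Basis: "(\<Sum>b\<in>Basis. representation Basis v b *s b) = v"
  by (rule sum_representation_eq) (auto simp: independent_Basis span_Basis finite_Basis)

text \<open>Extend \<open>vs\<close> to a basis \<open>B\<close> by vectors of \<open>Basis\<close>,
  and let \<open>I\<close> list the vectors of \<open>Basis\<close> that were not added. A
  combination of \<open>vs\<close> that vanishes on \<open>I\<close> lies in the span of the added
  vectors, so independence of \<open>B\<close> makes it trivial.\<close>

lemma plucker_independent:
  assumes "dim (span (set vs)) = length vs"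
  shows "\<exists>I. length I = length vs \<and> set I \<subseteq> Basis \<and> plucker vs I \<noteq> 0"
proof -
  let ?d = "length vs"
  have "card (set vs) \<le> ?d" by (rule card_length)
  then have card_vs: "card (set vs) = ?d"
    using dim_le_card[of "span (set vs)" "set vs"] assms by simp
  then have dist: "distinct vs" by (rule card_distinct)
  have ind: "independent (set vs)"
    using card_vs assms by (intro card_le_dim_spanning[of _ "span (set vs)"]) (auto intro: span_base)
  obtain B where B: "set vs \<subseteq> B" "B \<subseteq> set vs \<union> Basis" "independent B" "set vs \<union> Basis \<subseteq> span B"
    using maximal_independent_subset_extend[OF Un_upper1 ind] .
  have finB: "finite B" by (rule finiteI_independent[OF B(3)])
  have "span B = UNIV"
    using B(4) span_minimal[of Basis "span B"] span_Basis by auto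
  then have "card B = card Basis"
    using dim_span_eq_card_independent[OF B(3)] by simp
  moreover have "card B = ?d + card (B - set vs)"
    using card_vs B(1) finB card_mono[OF finB B(1)] by (simp add: card_Diff_subset)
  moreover have "B - set vs \<subseteq> Basis" using B(2) by blast
  ultimately have "card (Basis - (B - set vs)) = ?d"
    using finite_Basis finite_subset[OF \<open>B - set vs \<subseteq> Basis\<close>]
    by (simp add: card_Diff_subset)
  moreover obtain I where I: "set I = Basis - (B - set vs)" "distinct I"
    using finite_distinct_list[of "Basis - (B - set vs)"] finite_Basis by blast
  ultimately have len: "length I = ?d" using distinct_card by metis
  have "plucker vs I \<noteq> 0"
  proof
    assume "plucker vs I = 0"
    then obtain c r where r: "r < ?d" "c r \<noteq> 0"
      and c: "\<And>q. q < ?d \<Longrightarrow> representation Basis (\<Sum>r<?d. c r *s vs ! r) (I ! q) = 0"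
      unfolding plucker_eq_0_iff[OF len] by blast
    let ?x = "\<Sum>r<?d. c r *s vs ! r"
    let ?S = "span (B - {vs ! r})"
    have "representation Basis ?x b *s b \<in> ?S" if b: "b \<in> Basis" for b
    proof (cases "b \<in> B - set vs")
      case True
      then show ?thesis using r(1) by (intro span_scale span_base) auto
    next
      case False
      then have "b \<in> set I" using I b by blast
      then show ?thesis using c len by (metis in_set_conv_nth scale_zero_left span_zero)
    qed
    then have "(\<Sum>b\<in>Basis. representation Basis ?x b *s b) \<in> ?S"
      by (intro span_sum)
    then have "?x \<in> ?S" by (simp only: sum_representation_Basis)
    moreover have "(\<Sum>s\<in>{..<?d} - {r}. c s *s vs ! s) \<in> ?S"
    proof (intro span_sum span_scale span_base)
      fix s assume "s \<in> {..<?d} - {r}"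
      then have "vs ! s \<in> set vs" "vs ! s \<noteq> vs ! r"
        using dist r(1) by (auto simp: nth_eq_iff_index_eq)
      then show "vs ! s \<in> B - {vs ! r}" using B(1) by blast
    qed
    moreover have "?x = c r *s vs ! r + (\<Sum>s\<in>{..<?d} - {r}. c s *s vs ! s)"
      using r(1) by (subst sum.remove[of _ r]) auto
    ultimately have "c r *s vs ! r \<in> ?S" using span_diff by fastforce
    then have "inverse (c r) *s c r *s vs ! r \<in> ?S" by (rule span_scale)
    then have "vs ! r \<in> ?S" using r(2) by simp
    moreover have "vs ! r \<in> B" using B(1) r(1) by auto
    ultimately show False using B(3) unfolding dependent_def by blast
  qed
  then show ?thesis using len I(1) by blast
qed

text \<open>Up to sign, the contraction of the multivector with coordinates \<open>x\<close> by all
  entries of \<open>J\<close> except the one at \<open>p\<close>. It is linear in the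
  coordinates.\<close>

definition plucker_vector :: "('b list \<Rightarrow> 'a) \<Rightarrow> 'b list \<Rightarrow> nat \<Rightarrow> 'b" where
  "plucker_vector x J p = (\<Sum>b\<in>Basis. x (J[p := b]) *s b)"

lemma representation_combination:
  "c \<in> Basis \<Longrightarrow> representation Basis (\<Sum>b\<in>Basis. g b *s b) c = g c"
proof -
  assume c: "c \<in> Basis"
  have "representation Basis (\<Sum>b\<in>Basis. g b *s b) c =
      (\<Sum>b\<in>Basis. g b * representation Basis b c)"
    by (simp add: representation_sum[OF independent_Basis]
        representation_scale[OF independent_Basis] span_Basis)
  also have "\<dots> = (\<Sum>b\<in>Basis. if b = c then g c else 0)"
    by (intro sum.cong) (auto simp: representation_basis[OF independent_Basis])
  finally show ?thesis using c finite_Basis by simp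
qed

text \<open>Recovers a subspace from its Pluecker coordinates by linear formulas. Laplace expansion
  along column \<open>p\<close> writes each vector as a combination of \<open>vs\<close> with
  cofactors as coefficients. Conversely, for \<open>I\<close> with nonzero minor, the vectors
  belonging to \<open>I\<close> have a nonzero multiple of the identity as their coordinates on
  \<open>I\<close>.\<close>

lemma span_plucker_vectors:
  assumes "dim (span (set vs)) = length vs"
    and x: "\<And>I. length I = length vs \<Longrightarrow> set I \<subseteq> Basis \<Longrightarrow> x I = plucker vs I"
  shows "span {plucker_vector x J p | J p. length J = length vs \<and> set J \<subseteq> Basis \<and> p < length J}
    = span (set vs)" (is "span ?P = _")
proof
  let ?d = "length vs"
  have sub: "plucker_vector x J p \<in> span (set vs)"
    if J: "length J = ?d" "set J \<subseteq> Basis" "p < ?d" for J p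
  proof -
    let ?M = "\<lambda>J. mat ?d ?d (\<lambda>(r, q). representation Basis (vs ! r) (J ! q))"
    have "x (J[p := b]) = (\<Sum>r<?d. representation Basis (vs ! r) b * cofactor (?M J) r p)"
      if b: "b \<in> Basis" for b
    proof -
      have "set (J[p := b]) \<subseteq> Basis"
        using J b set_update_subset_insert[of J p b] by auto
      then have "x (J[p := b]) = det (?M (J[p := b]))"
        using x[of "J[p := b]"] J by (simp add: plucker_def)
      also have "\<dots> = (\<Sum>r<?d. ?M (J[p := b]) $$ (r, p) * cofactor (?M (J[p := b])) r p)"
        by (rule laplace_expansion_column) (use J in auto)
      also have "\<dots> = (\<Sum>r<?d. representation Basis (vs ! r) b * cofactor (?M J) r p)"
      proof (rule sum.cong)
        fix r assume "r \<in> {..<?d}"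
        have "mat_delete (?M (J[p := b])) r p = mat_delete (?M J) r p"
          by (rule eq_matI) (auto simp: mat_delete_def nth_list_update)
        then show "?M (J[p := b]) $$ (r, p) * cofactor (?M (J[p := b])) r p =
            representation Basis (vs ! r) b * cofactor (?M J) r p"
          using \<open>r \<in> {..<?d}\<close> J by (simp add: cofactor_def)
      qed simp
      finally show ?thesis .
    qed
    then have "plucker_vector x J p =
        (\<Sum>b\<in>Basis. \<Sum>r<?d. cofactor (?M J) r p *s representation Basis (vs ! r) b *s b)"
      unfolding plucker_vector_def
      by (intro sum.cong) (simp_all add: scale_sum_left mult.commute)
    also have "\<dots> = (\<Sum>r<?d. cofactor (?M J) r p *s
        (\<Sum>b\<in>Basis. representation Basis (vs ! r) b *s b))"
      by (subst sum.swap) (simp only: scale_sum_right)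
    also have "\<dots> = (\<Sum>r<?d. cofactor (?M J) r p *s vs ! r)"
      by (simp add: sum_representation_Basis)
    also have "\<dots> \<in> span (set vs)"
      by (intro span_sum span_scale span_base) auto
    finally show ?thesis .
  qed
  then show "span ?P \<subseteq> span (set vs)"
    by (intro span_minimal) auto
  obtain I where I: "length I = ?d" "set I \<subseteq> Basis" "plucker vs I \<noteq> 0"
    using plucker_independent[OF assms(1)] by blast
  \<comment> \<open>As the minor on \<open>I\<close> is nonzero, elements of the span are determined
    by their coordinates on \<open>I\<close>.\<close>
  have inj: "y = 0" if y: "y \<in> span (set vs)" "\<And>q. q < ?d \<Longrightarrow> representation Basis y (I ! q) = 0"
    for y
  proof -
    obtain c where c: "y = (\<Sum>r<?d. c r *s vs ! r)"
      using in_span_list[OF y(1)] by blast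
    have "c r = 0" if "r < ?d" for r
      using I(3) that y(2) unfolding plucker_eq_0_iff[OF I(1)] c by blast
    then show ?thesis unfolding c by (intro sum.neutral) auto
  qed
  \<comment> \<open>Off the diagonal the updated list has the same column at \<open>p\<close> and at
    \<open>q\<close>, so the minor vanishes.\<close>
  have diag: "representation Basis (plucker_vector x I p) (I ! q) =
      (if p = q then plucker vs I else 0)" if "p < ?d" "q < ?d" for p q
  proof -
    have Iq: "I ! q \<in> Basis" using I that by (metis nth_mem subsetD)
    have sub': "set (I[p := I ! q]) \<subseteq> Basis"
      using I Iq set_update_subset_insert[of I p "I ! q"] by auto
    have "representation Basis (plucker_vector x I p) (I ! q) = x (I[p := I ! q])"
      unfolding plucker_vector_def by (rule representation_combination[OF Iq])
    also have "\<dots> = plucker vs (I[p := I ! q])" using x sub' I(1) by simp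
    also have "\<dots> = (if p = q then plucker vs I else 0)"
    proof (cases "p = q")
      case False
      have "plucker vs (I[p := I ! q]) = 0"
        unfolding plucker_def using False that I(1)
        by (intro det_identical_columns[of _ ?d p q]) (auto simp: nth_list_update)
      then show ?thesis using False by simp
    qed simp
    finally show ?thesis .
  qed
  show "span (set vs) \<subseteq> span ?P"
  proof
    fix v assume v: "v \<in> span (set vs)"
    let ?w = "\<Sum>p<?d. (representation Basis v (I ! p) / plucker vs I) *s plucker_vector x I p"
    have w: "?w \<in> span (set vs)" using sub[OF I(1,2)] by (intro span_sum span_scale) auto
    have "v - ?w = 0"
    proof (rule inj)
      show "v - ?w \<in> span (set vs)" by (rule span_diff[OF v w])
      fix q assume q: "q < ?d"
      have "representation Basis ?w (I ! q) =
          (\<Sum>p<?d. representation Basis v (I ! p) / plucker vs I *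
             representation Basis (plucker_vector x I p) (I ! q))"
        by (simp add: representation_sum[OF independent_Basis]
            representation_scale[OF independent_Basis] span_Basis)
      also have "\<dots> = (\<Sum>p<?d. if p = q then representation Basis v (I ! q) else 0)"
        using q I(3) by (intro sum.cong) (auto simp: diag)
      finally show "representation Basis (v - ?w) (I ! q) = 0"
        using q by (simp add: representation_diff[OF independent_Basis] span_Basis)
    qed
    moreover have "plucker_vector x I p \<in> ?P" if "p < ?d" for p
      using I(1,2) that by (intro CollectI exI[of _ I] exI[of _ p]) simp
    then have "?w \<in> span ?P" by (intro span_sum span_scale span_base) simp
    ultimately show "v \<in> span ?P" by simp
  qed
qed

section \<open>Multihomogeneous polynomials and curves of flags\<close>

lemma multihom_sum:
  assumes "finite A" "A \<noteq> {}" "\<And>a. a \<in> A \<Longrightarrow> multihom d (p a)"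
  shows "multihom d (\<lambda>x. \<Sum>a\<in>A. p a x)"
  using assms by (induction A rule: finite_ne_induct) (auto intro: multihom.add)

lemma multihom_prod:
  assumes "finite A" "\<And>a. a \<in> A \<Longrightarrow> multihom (d a) (p a)"
  shows "multihom (\<lambda>i. \<Sum>a\<in>A. d a i) (\<lambda>x. \<Prod>a\<in>A. p a x)"
  using assms
proof (induction A rule: finite_induct)
  case empty
  then show ?case using multihom.const[of 1] by simp
next
  case (insert a A)
  then show ?case
    using multihom.mult[of "d a" "p a" "\<lambda>i. \<Sum>a\<in>A. d a i" "\<lambda>x. \<Prod>a\<in>A. p a x"] by simp
qed

lemma multihom_cmult: "multihom d p \<Longrightarrow> multihom d (\<lambda>x. a * p x)"
  using multihom.mult[OF multihom.const[of a], of d p] by simp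

text \<open>In the Leibniz formula every term takes one entry from each row, so all terms have the
  sum of the row degrees as multidegree.\<close>

lemma multihom_plucker:
  assumes "\<And>r b. r < length I \<Longrightarrow> b \<in> Basis \<Longrightarrow>
    multihom (d r) (\<lambda>x. representation Basis (vs x ! r) b)" "set I \<subseteq> Basis"
  shows "multihom (\<lambda>i. \<Sum>r<length I. d r i) (\<lambda>x. plucker (vs x) I)"
proof -
  let ?n = "length I"
  have eq: "plucker (vs x) I = (\<Sum>\<pi>\<in>{\<pi>. \<pi> permutes {0..<?n}}. signof \<pi> *
      (\<Prod>r<?n. representation Basis (vs x ! r) (I ! \<pi> r)))" for x
    unfolding plucker_def
    by (subst det_def'[of _ ?n])
      (auto simp: atLeast0LessThan permutes_in_image intro!: sum.cong prod.cong)
  show ?thesis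
    unfolding eq
  proof (intro multihom_sum multihom_cmult multihom_prod)
    show "finite {\<pi>. \<pi> permutes {0..<?n}}" by (simp add: finite_permutations)
    show "{\<pi>. \<pi> permutes {0..<?n}} \<noteq> {}" using permutes_id by blast
    fix \<pi> r assume "\<pi> \<in> {\<pi>. \<pi> permutes {0..<?n}}" "r \<in> {..<?n}"
    then have "r < ?n" "\<pi> r < ?n" using permutes_in_image[of \<pi> "{0..<?n}" r] by auto
    then show "multihom (d r) (\<lambda>x. representation Basis (vs x ! r) (I ! \<pi> r))"
      using assms by (meson nth_mem subsetD)
  qed simp
qed

lemma linear_shear:
  assumes "Vector_Spaces.linear scale scale a"
  shows "Vector_Spaces.linear scale scale (\<lambda>x. x + t *s a x)"
proof -
  interpret a: Vector_Spaces.linear scale scale a by fact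
  show ?thesis
    by unfold_locales (simp_all add: a.add a.scale algebra_simps)
qed

text \<open>Some multihomogeneous \<open>p\<close> vanishes on the complement of \<open>V\<close>
  but not at \<open>f\<close>. Along the curve its value is a polynomial in \<open>t\<close> that is
  nonzero at \<open>t = 0\<close>. Every \<open>t\<close> with \<open>F t\<close> outside
  \<open>V\<close> is one of its finitely many roots.\<close>

lemma open_contains_curve:
  assumes "openin flag_topology V" "f \<in> V" and a: "Vector_Spaces.linear scale scale a"
    and F: "\<And>t. complete_flag (F t)" "\<And>t i. i \<le> dim UNIV \<Longrightarrow> F t i = (\<lambda>x. x + t *s a x) ` f i"
  shows "finite {t. F t \<notin> V}"
proof -
  let ?g = "\<lambda>t x. x + t *s a x"
  define polynomial where "polynomial h \<longleftrightarrow> (\<exists>q. \<forall>t. h t = poly q t)" for h :: "'a \<Rightarrow> 'a"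
  have poly_const: "polynomial (\<lambda>t. b)" for b
    unfolding polynomial_def by (intro exI[of _ "[:b:]"]) simp
  have poly_add: "polynomial (\<lambda>t. h t + k t)" if "polynomial h" "polynomial k" for h k
    using that unfolding polynomial_def by (metis poly_add)
  have poly_mult: "polynomial (\<lambda>t. h t * k t)" if "polynomial h" "polynomial k" for h k
    using that unfolding polynomial_def by (metis poly_mult)
  have poly_sum: "polynomial (\<lambda>t. \<Sum>s\<in>A. h s t)" if "\<And>s. s \<in> A \<Longrightarrow> polynomial (h s)" for h A
    using that by (induction A rule: infinite_finite_induct) (auto intro: poly_const poly_add)
  have poly_prod: "polynomial (\<lambda>t. \<Prod>s\<in>A. h s t)" if "\<And>s. s \<in> A \<Longrightarrow> polynomial (h s)" for h A
    using that by (induction A rule: infinite_finite_induct) (auto intro: poly_const poly_mult)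
  obtain S where S: "\<And>p. p \<in> S \<Longrightarrow> \<exists>d. multihom d p" "Collect complete_flag - V = zero_set S"
    and "V \<subseteq> Collect complete_flag"
    using assms(1) unfolding openin_flag_topology zariski_closed_def by metis
  then have "complete_flag f" "f \<notin> zero_set S" using assms(2) by auto
  then obtain x0 p where p: "homogeneous_coords f x0" "p \<in> S" "p x0 \<noteq> 0"
    unfolding zero_set_def by blast
  obtain d where d: "multihom d p" using S(1) p(2) by blast
  obtain vs where vs: "\<And>i. i \<le> dim UNIV \<Longrightarrow> length (vs i) = i"
      "\<And>i. i \<le> dim UNIV \<Longrightarrow> span (set (vs i)) = f i"
    using p(1) unfolding homogeneous_coords_def by metis
  \<comment> \<open>Coordinates of the moved flag from fixed bases of the spaces of
    \<open>f\<close>, transported by \<open>1 + t a\<close>; this choice makes every coordinate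
    polynomial in \<open>t\<close>.\<close>
  define y where "y t I = plucker (map (?g t) (vs (length I))) I" for t I
  have coords: "homogeneous_coords h (y t)"
    if "\<And>i. i \<le> dim UNIV \<Longrightarrow> h i = ?g t ` f i" for h t
    unfolding homogeneous_coords_def
  proof (intro allI impI)
    fix i assume i: "i \<le> dim UNIV"
    interpret g: Vector_Spaces.linear scale scale "?g t" by (rule linear_shear[OF a])
    show "\<exists>ws. length ws = i \<and> span (set ws) = h i \<and>
        (\<forall>I. length I = i \<and> set I \<subseteq> Basis \<longrightarrow> y t I = plucker ws I)"
      using vs[OF i] that[OF i] g.span_image[of "set (vs i)"]
      by (intro exI[of _ "map (?g t) (vs i)"]) (auto simp: y_def)
  qed
  have "homogeneous_coords f (y 0)" by (rule coords) simp
  then have "p (y 0) \<noteq> 0" using multihom_zero_indep[OF _ p(1) d] p(3) by blast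
  have "polynomial (\<lambda>t. p (y t))"
    using d
  proof induction
    case (coord I)
    then have len: "length (vs (length I)) = length I" using vs(1) by simp
    have "y t I = (\<Sum>\<pi>\<in>{\<pi>. \<pi> permutes {0..<length I}}. signof \<pi> *
      (\<Prod>r<length I. representation Basis (vs (length I) ! r) (I ! \<pi> r) +
         t * representation Basis (a (vs (length I) ! r)) (I ! \<pi> r)))" for t
      unfolding y_def plucker_def
      by (subst det_def'[of _ "length I"])
        (auto simp: atLeast0LessThan permutes_in_image len representation_add[OF independent_Basis]
          representation_scale[OF independent_Basis] span_Basis intro!: sum.cong prod.cong)
    moreover have "polynomial (\<lambda>t. t)" unfolding polynomial_def by (intro exI[of _ "[:0, 1:]"]) simp
    ultimately show ?case
      by (simp only:) (intro poly_sum poly_mult poly_prod poly_add poly_const)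
  qed (auto intro: poly_const poly_add poly_mult)
  then obtain q where q: "\<And>t. p (y t) = poly q t" unfolding polynomial_def by blast
  have "q \<noteq> 0" using q[of 0] \<open>p (y 0) \<noteq> 0\<close> by auto
  have "F t \<in> V" if "poly q t \<noteq> 0" for t
  proof -
    have "homogeneous_coords (F t) (y t)" by (rule coords) (rule F(2))
    moreover have "p (y t) \<noteq> 0" using that q by simp
    ultimately have "F t \<notin> zero_set S"
      using p(2) unfolding zero_set_def by blast
    then show ?thesis using S(2) F(1) by blast
  qed
  then have "{t. F t \<notin> V} \<subseteq> {t. poly q t = 0}" by blast
  then show ?thesis using poly_roots_finite[OF \<open>q \<noteq> 0\<close>] finite_subset by blast
qed

end

section \<open>Generic flags\<close>

context nilpotent_endo
begin

text \<open>Indices for vectors spanning \<open>power_image k (f b) (f a)\<close>: \<eta>^k is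
  applied to the vectors from \<open>f b\<close>, and \<eta>^0 to those from \<open>f a\<close>. The
  index set does not depend on the flag, so minors of these vectors are polynomials on the whole
  flag variety.\<close>

definition generators :: "nat \<Rightarrow> nat \<Rightarrow> nat \<Rightarrow> (nat \<times> 'b list \<times> nat) set" where
  "generators k b a = {(m, J, p). (m = k \<and> length J = b \<or> m = 0 \<and> length J = a) \<and>
     set J \<subseteq> Basis \<and> p < length J}"

fun generator_vector :: "('b list \<Rightarrow> 'a) \<Rightarrow> nat \<times> 'b list \<times> nat \<Rightarrow> 'b" where
  "generator_vector x (m, J, p) = (\<eta> ^^ m) (plucker_vector x J p)"

lemma span_generator_vectors:
  assumes "complete_flag f" "homogeneous_coords f x" "a \<le> dim UNIV" "b \<le> dim UNIV"
  shows "span (generator_vector x ` generators k b a) = power_image k (f b) (f a)"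
proof -
  let ?P = "\<lambda>i. {plucker_vector x J p | J p. length J = i \<and> set J \<subseteq> Basis \<and> p < length J}"
  have span: "span (?P i) = f i" if i: "i \<le> dim UNIV" for i
  proof -
    obtain vs where vs: "length vs = i" "span (set vs) = f i"
        "\<And>I. length I = i \<Longrightarrow> set I \<subseteq> Basis \<Longrightarrow> x I = plucker vs I"
      using assms(2) i unfolding homogeneous_coords_def by meson
    have "dim (f i) = i" using assms(1) i unfolding complete_flag_def by blast
    then have "dim (span (set vs)) = length vs" by (simp only: vs)
    from span_plucker_vectors[OF this, of x] show ?thesis using vs by simp
  qed
  have "generator_vector x ` generators k b a = (\<eta> ^^ k) ` ?P b \<union> ?P a"
  proof (intro equalityI subsetI)
    fix y assume "y \<in> generator_vector x ` generators k b a"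
    then obtain m J p where y: "y = (\<eta> ^^ m) (plucker_vector x J p)" "(m, J, p) \<in> generators k b a"
      by auto
    then have "plucker_vector x J p \<in> ?P (length J)" "m = k \<and> length J = b \<or> m = 0 \<and> length J = a"
      unfolding generators_def by auto
    then show "y \<in> (\<eta> ^^ k) ` ?P b \<union> ?P a" unfolding y(1) by auto
  next
    fix y assume "y \<in> (\<eta> ^^ k) ` ?P b \<union> ?P a"
    then consider J p where "y = generator_vector x (k, J, p)" "(k, J, p) \<in> generators k b a"
      | J p where "y = generator_vector x (0, J, p)" "(0, J, p) \<in> generators k b a"
      unfolding generators_def by auto
    then show "y \<in> generator_vector x ` generators k b a" by cases blast+
  qed
  then have "span (generator_vector x ` generators k b a) =
      {y + z | y z. y \<in> (\<eta> ^^ k) ` span (?P b) \<and> z \<in> span (?P a)}"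
    by (simp add: span_Un pow.span_image)
  also have "\<dots> = power_image k (f b) (f a)"
    unfolding span[OF assms(3)] span[OF assms(4)] power_image_def by blast
  finally show ?thesis .
qed

lemma multihom_generator_vector:
  assumes "(m, J, p) \<in> generators k b a" "a \<le> dim UNIV" "b \<le> dim UNIV" "c \<in> Basis"
  shows "multihom (\<lambda>i. if i = length J then 1 else 0)
    (\<lambda>x. representation Basis (generator_vector x (m, J, p)) c)"
proof -
  have J: "set J \<subseteq> Basis" "length J \<le> dim UNIV" "p < length J"
    using assms(1-3) unfolding generators_def by auto
  have eq: "representation Basis (generator_vector x (m, J, p)) c =
      (\<Sum>e\<in>Basis. representation Basis ((\<eta> ^^ m) e) c * x (J[p := e]))" for x
    by (simp add: plucker_vector_def pow.sum pow.scale representation_sum[OF independent_Basis]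
        representation_scale[OF independent_Basis] span_Basis mult.commute)
  show ?thesis
    unfolding eq
  proof (intro multihom_sum multihom_cmult finite_Basis)
    show "Basis \<noteq> {}" using assms(4) by blast
    fix e assume "e \<in> Basis"
    then have "set (J[p := e]) \<subseteq> Basis" using J(1) set_update_subset_insert[of J p e] by auto
    then show "multihom (\<lambda>i. if i = length J then 1 else 0) (\<lambda>x. x (J[p := e]))"
      using multihom.coord[of "J[p := e]"] J(2) by simp
  qed
qed

text \<open>Lower semicontinuity of rank: the dimension is at least \<open>d\<close> exactly when
  some \<open>d\<close> generators have a nonzero minor of size \<open>d\<close>, so the complement
  is the zero set of all these minors.\<close>

lemma open_dim_power_image_ge:
  assumes "a \<le> dim UNIV" "b \<le> dim UNIV"
  shows "openin flag_topology {f. complete_flag f \<and> d \<le> dim (power_image k (f b) (f a))}"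
proof -
  define S where "S = {\<lambda>x. plucker (map (generator_vector x) gs) I | gs I.
    length gs = d \<and> length I = d \<and> set gs \<subseteq> generators k b a \<and> set I \<subseteq> Basis}"
  have "\<exists>e. multihom e p" if "p \<in> S" for p
  proof -
    obtain gs I where gs: "length gs = d" "length I = d" "set gs \<subseteq> generators k b a"
        "set I \<subseteq> Basis" and p: "p = (\<lambda>x. plucker (map (generator_vector x) gs) I)"
      using \<open>p \<in> S\<close> unfolding S_def by blast
    let ?d = "\<lambda>r i. if i = length (fst (snd (gs ! r))) then 1 else 0"
    have "multihom (\<lambda>i. \<Sum>r<length I. ?d r i) p"
      unfolding p
    proof (rule multihom_plucker[OF _ gs(4)])
      fix r c assume r: "r < length I" and c: "c \<in> Basis"
      obtain m J q where g: "gs ! r = (m, J, q)" by (cases "gs ! r")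
      then have "(m, J, q) \<in> generators k b a"
        using gs r by (metis nth_mem subsetD)
      from multihom_generator_vector[OF this assms c]
      show "multihom (?d r) (\<lambda>x. representation Basis (map (generator_vector x) gs ! r) c)"
        using r gs(1,2) g by simp
    qed
    then show ?thesis by blast
  qed
  moreover have "Collect complete_flag - {f. complete_flag f \<and> d \<le> dim (power_image k (f b) (f a))}
      = zero_set S"
  proof (intro equalityI subsetI)
    fix f assume "f \<in> Collect complete_flag - {f. complete_flag f \<and> d \<le> dim (power_image k (f b) (f a))}"
    then have f: "complete_flag f" "dim (power_image k (f b) (f a)) < d" by auto
    have "plucker (map (generator_vector x) gs) I = 0"
      if "homogeneous_coords f x" "length gs = d" "length I = d" "set gs \<subseteq> generators k b a" for x gs I
    proof (rule plucker_dependent)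
      have "dim (span (set (map (generator_vector x) gs))) \<le>
          dim (span (generator_vector x ` generators k b a))"
        using that(4) by (intro dim_subset span_mono) auto
      then show "dim (span (set (map (generator_vector x) gs))) < length (map (generator_vector x) gs)"
        using f that(2) span_generator_vectors[OF f(1) that(1) assms] by simp
    qed (use that in simp)
    then show "f \<in> zero_set S" using f(1) unfolding zero_set_def S_def by auto
  next
    fix f assume f: "f \<in> zero_set S"
    then have flag: "complete_flag f" by (simp add: zero_set_def)
    obtain x where x: "homogeneous_coords f x" using homogeneous_coords_exist[OF flag] by blast
    have "\<not> d \<le> dim (power_image k (f b) (f a))"
    proof
      assume d: "d \<le> dim (power_image k (f b) (f a))"
      obtain B where B: "B \<subseteq> generator_vector x ` generators k b a" "independent B"
          "generator_vector x ` generators k b a \<subseteq> span B"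
          "card B = dim (generator_vector x ` generators k b a)"
        using basis_exists .
      have "card B = dim (power_image k (f b) (f a))"
        using B(4) span_generator_vectors[OF flag x assms] dim_span by metis
      then obtain C where C: "C \<subseteq> B" "card C = d"
        using d obtain_subset_with_card_n by metis
      have indC: "independent C" using B(2) C(1) by (rule independent_mono)
      then obtain vs where vs: "set vs = C" "distinct vs"
        using finite_distinct_list[OF finiteI_independent] by blast
      have "\<exists>g\<in>generators k b a. v = generator_vector x g" if "v \<in> set vs" for v
        using that vs C(1) B(1) by blast
      \<comment> \<open>The polynomials in \<open>S\<close> are indexed by lists of generators, so
        the \<open>d\<close> independent vectors found at this flag are lifted to their
        indices.\<close>
      then obtain h where h: "\<And>v. v \<in> set vs \<Longrightarrow> h v \<in> generators k b a \<and> v = generator_vector x (h v)"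
        by metis
      then have map: "map (generator_vector x) (map h vs) = vs"
        by (auto intro!: map_idI simp: comp_def)
      have len: "length vs = d" using vs C(2) distinct_card by metis
      have "dim (span (set vs)) = length vs"
        using dim_span_eq_card_independent[OF indC] vs C(2) len by simp
      then obtain I where I: "length I = d" "set I \<subseteq> Basis" "plucker vs I \<noteq> 0"
        using plucker_independent len by metis
      have "(\<lambda>x. plucker (map (generator_vector x) (map h vs)) I) \<in> S"
        unfolding S_def using I len h by (intro CollectI exI[of _ "map h vs"] exI[of _ I]) auto
      then have "plucker (map (generator_vector x) (map h vs)) I = 0"
        using f x unfolding zero_set_def by fastforce
      then show False using map I(3) by simp
    qed
    then show "f \<in> Collect complete_flag - {f. complete_flag f \<and> d \<le> dim (power_image k (f b) (f a))}"
      using flag by simp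
  qed
  ultimately show ?thesis
    unfolding openin_flag_topology zariski_closed_def by auto
qed

section \<open>The locus where the ranks are locally constant\<close>

definition same_ranks :: "(nat \<Rightarrow> 'b set) \<Rightarrow> (nat \<Rightarrow> 'b set) \<Rightarrow> bool" where
  "same_ranks f g \<longleftrightarrow> (\<forall>a\<le>dim UNIV. \<forall>b\<le>dim UNIV. \<forall>k.
     dim (power_image k (f b) (f a)) = dim (power_image k (g b) (g a)))"

lemma same_ranks_euclidean: "same_ranks f g \<Longrightarrow> same_ranks f h \<Longrightarrow> same_ranks g h"
  by (simp add: same_ranks_def)

text \<open>Neighbourhoods are taken within the variety of \<eta>-stable flags, where the ranks are
  to be locally constant.\<close>

definition generic_flags :: "(nat \<Rightarrow> 'b set) set" where
  "generic_flags = {f. \<exists>V. openin (stable_flag_variety \<eta>) V \<and> f \<in> V \<and> (\<forall>g\<in>V. same_ranks f g)}"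

lemma generic_flags_subset: "generic_flags \<subseteq> stable_flags \<eta>"
proof
  fix f assume "f \<in> generic_flags"
  then obtain V where "openin (stable_flag_variety \<eta>) V" "f \<in> V"
    unfolding generic_flags_def by blast
  then show "f \<in> stable_flags \<eta>"
    using openin_subset[of "stable_flag_variety \<eta>" V]
    unfolding topspace_stable_flag_variety by blast
qed

lemma openin_generic_flags: "openin (stable_flag_variety \<eta>) generic_flags"
proof (subst openin_subopen, intro ballI)
  fix f assume "f \<in> generic_flags"
  then obtain V where V: "openin (stable_flag_variety \<eta>) V" "f \<in> V" "\<And>g. g \<in> V \<Longrightarrow> same_ranks f g"
    unfolding generic_flags_def by blast
  have "V \<subseteq> generic_flags"
    unfolding generic_flags_def using V(1) same_ranks_euclidean[OF V(3) V(3)] by blast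
  then show "\<exists>T. openin (stable_flag_variety \<eta>) T \<and> f \<in> T \<and> T \<subseteq> generic_flags"
    using V by blast
qed

lemma stable_flagD:
  assumes "f \<in> stable_flags \<eta>"
  shows "i \<le> dim UNIV \<Longrightarrow> invariant (f i)" "i \<le> dim UNIV \<Longrightarrow> dim (f i) = i"
    "i \<le> j \<Longrightarrow> j \<le> dim UNIV \<Longrightarrow> f i \<subseteq> f j"
proof -
  have f: "complete_flag f" "\<And>i. i \<le> dim UNIV \<Longrightarrow> \<eta> ` f i \<subseteq> f i"
    using assms unfolding stable_flags_def by auto
  show "i \<le> dim UNIV \<Longrightarrow> invariant (f i)" "i \<le> dim UNIV \<Longrightarrow> dim (f i) = i"
    using f unfolding invariant_def complete_flag_def by blast+
  have step: "f i \<subset> f (Suc i)" if "i < dim UNIV" for i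
    using f(1) that unfolding complete_flag_def by blast
  show "i \<le> j \<Longrightarrow> j \<le> dim UNIV \<Longrightarrow> f i \<subseteq> f j"
  proof (induction j rule: dec_induct)
    case (step j)
    then show ?case using \<open>\<And>i. i < dim UNIV \<Longrightarrow> f i \<subset> f (Suc i)\<close>[of j] by auto
  qed simp
qed

text \<open>In a nonempty open \<open>T\<close> choose \<open>f\<close> with the largest sum of
  ranks. By semicontinuity no rank drops on a neighbourhood of \<open>f\<close>, and maximality of
  the sum then keeps every rank equal.\<close>

lemma dense_generic_flags:
  "stable_flag_variety \<eta> closure_of generic_flags = topspace (stable_flag_variety \<eta>)"
  unfolding dense_intersects_open
proof (intro allI impI, elim conjE)
  fix T assume T: "openin (stable_flag_variety \<eta>) T" "T \<noteq> {}"
  have stable: "f \<in> stable_flags \<eta>" if "f \<in> T" for f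
    using that openin_subset[OF T(1)] unfolding topspace_stable_flag_variety by blast
  \<comment> \<open>From exponent \<open>N\<close> on, \<open>power_image k (f b) (f a)\<close> is
    just \<open>f a\<close>, of dimension \<open>a\<close>; finitely many ranks therefore
    suffice.\<close>
  obtain N where N: "\<And>k W U. k \<ge> N \<Longrightarrow> subspace W \<Longrightarrow> power_image k W U = U"
    using power_image_eventually by blast
  define A where "A = {..dim UNIV} \<times> {..dim UNIV} \<times> {..<N}"
  define \<rho> where "\<rho> f s = (case s of (a, b, k) \<Rightarrow> dim (power_image k (f b) (f a)))" for f :: "nat \<Rightarrow> 'b set" and s
  have finA: "finite A" by (simp add: A_def)
  obtain f0 where "f0 \<in> T" using T(2) by blast
  have bound: "(\<Sum>s\<in>A. \<rho> f s) < Suc (card A * dim UNIV)" for f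
  proof -
    have "\<rho> f s \<le> dim UNIV" for s
      by (cases s) (auto simp: \<rho>_def simp del: dim_UNIV intro!: dim_subset)
    then show ?thesis
      using sum_bounded_above[of A "\<rho> f" "dim UNIV"] by (simp add: less_Suc_eq_le)
  qed
  obtain f where f: "f \<in> T" "\<And>g. g \<in> T \<Longrightarrow> (\<Sum>s\<in>A. \<rho> g s) \<le> (\<Sum>s\<in>A. \<rho> f s)"
    using ex_has_greatest_nat[of "\<lambda>g. g \<in> T" f0 "\<lambda>g. \<Sum>s\<in>A. \<rho> g s"] \<open>f0 \<in> T\<close> bound by metis
  define G where "G s = {g. complete_flag g \<and> \<rho> f s \<le> \<rho> g s}" for s
  have "openin flag_topology (G s)" if "s \<in> A" for s
  proof -
    obtain a b k where s: "s = (a, b, k)" by (cases s)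
    then show ?thesis
      using open_dim_power_image_ge[of a b "\<rho> f s" k] that by (simp add: G_def \<rho>_def A_def)
  qed
  then have "openin (stable_flag_variety \<eta>) (T \<inter> G s)" if "s \<in> A" for s
    using that T(1) unfolding stable_flag_variety_def openin_subtopology
    by (metis (no_types, lifting) inf.assoc inf.commute openin_Int)
  then have "openin (stable_flag_variety \<eta>) (\<Inter>s\<in>A. T \<inter> G s)" if "A \<noteq> {}"
    using finA that by (intro openin_INT2)
  \<comment> \<open>The additional factor \<open>T\<close> covers the case of empty
    \<open>A\<close>, where the indexed intersection is the universe.\<close>
  then have "openin (stable_flag_variety \<eta>) (T \<inter> (\<Inter>s\<in>A. T \<inter> G s))"
    using T(1) by (cases "A = {}") (simp_all only: INF_empty Int_UNIV_right openin_Int not_False_eq_True)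
  moreover have "f \<in> T \<inter> (\<Inter>s\<in>A. T \<inter> G s)"
    using f(1) stable[OF f(1)] by (auto simp: G_def stable_flags_def)
  moreover have "dim (power_image k (f b) (f a)) = dim (power_image k (g b) (g a))"
    if g: "g \<in> T \<inter> (\<Inter>s\<in>A. T \<inter> G s)" and ab: "a \<le> dim UNIV" "b \<le> dim UNIV" for g a b k
  proof (cases "k < N")
    case True
    have le: "\<forall>s\<in>A. \<rho> f s \<le> \<rho> g s" using g unfolding G_def by blast
    have "\<rho> f s = \<rho> g s" if "s \<in> A" for s
    proof (rule ccontr)
      assume "\<rho> f s \<noteq> \<rho> g s"
      then have "(\<Sum>s\<in>A. \<rho> f s) < (\<Sum>s\<in>A. \<rho> g s)"
        using le that finA by (intro sum_strict_mono_ex1) (auto simp: le_less)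
      moreover have "g \<in> T" using g by blast
      ultimately show False using f(2) by fastforce
    qed
    from this[of "(a, b, k)"] show ?thesis using ab True by (simp add: A_def \<rho>_def)
  next
    case False
    have "g \<in> stable_flags \<eta>" "f \<in> stable_flags \<eta>" using g stable f(1) by auto
    then show ?thesis
      using False N[of k] stable_flagD[of g] stable_flagD[of f] invariant_subspace ab by (metis not_less)
  qed
  then have "same_ranks f g" if "g \<in> T \<inter> (\<Inter>s\<in>A. T \<inter> G s)" for g
    unfolding same_ranks_def using that by blast
  ultimately have "f \<in> generic_flags" unfolding generic_flags_def by blast
  then show "generic_flags \<inter> T \<noteq> {}" using f(1) by blast
qed

end

section \<open>Deforming a flag\<close>

context nilpotent_endo
begin

text \<open>If the Jordan type of \<open>H/U\<close> has two rows of length \<open>Suc p\<close>, then some such chain ends outside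
  \<open>\<eta>\<^bsup>p+1\<^esup> W + U\<close>, because \<open>\<eta>\<^bsup>p+1\<^esup> H + U\<close> has codimension one there.\<close>

lemma exists_chain_end_notin:
  assumes inv: "invariant U" "invariant H" "invariant W" and sub: "U \<subseteq> H" "H \<subseteq> W"
    and dim: "dim (power_image (Suc p) W U) = Suc (dim (power_image (Suc p) H U))"
    and col: "column_length (jordan_type \<eta> H U) p \<ge> column_length (jordan_type \<eta> H U) (Suc p) + 2"
  shows "\<exists>u\<in>H. (\<eta> ^^ Suc p) u \<in> U \<and> (\<eta> ^^ p) u \<notin> power_image (Suc p) W U"
proof -
  note U = invariant_subspace[OF inv(1)] and H = invariant_subspace[OF inv(2)]
    and W = invariant_subspace[OF inv(3)]
  define \<mu> where "\<mu> = jordan_type \<eta> H U"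
  have part: "is_partition \<mu>" unfolding \<mu>_def by (rule jordan_type_basis[OF inv(1,2) sub(1)])
  obtain e where e: "jordan_basis \<eta> H U \<mu> e"
    unfolding \<mu>_def using jordan_type_basis[OF inv(1,2) sub(1)] by blast
  note J = e[unfolded jordan_basis_iff[OF inv(1) H sub(1) part]]
  have fin: "finite (young_diagram \<mu>)" by (rule finite_young_diagram[OF part])
  let ?D = "diagram_from \<mu> (Suc p)" and ?PH = "power_image (Suc p) H U"
    and ?PW = "power_image (Suc p) W U"
  note PH = subspace_power_image[OF H U, of "Suc p"] and PW = subspace_power_image[OF W U, of "Suc p"]
  \<comment> \<open>Rows count from 0, so this is the first row of length at most
    \<open>Suc p\<close>; by \<open>col\<close>, it and the next row have length exactly
    \<open>Suc p\<close>.\<close>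
  define i1 where "i1 = column_length \<mu> (Suc p)"
  have rows: "\<mu> i = Suc p" if "i \<in> {i1, Suc i1}" for i
  proof -
    have "i < column_length \<mu> p" "\<not> i < column_length \<mu> (Suc p)"
      using that col unfolding i1_def \<mu>_def by auto
    then show ?thesis using less_partition_iff[OF part] by (metis not_less_eq linorder_neqE_nat)
  qed
  have mem: "(i, j) \<in> young_diagram \<mu>" if "i \<in> {i1, Suc i1}" "j \<le> p" for i j
    using rows[OF that(1)] that(2) by (simp add: young_diagram_def)
  have notin_D: "(i, 0) \<notin> ?D" if "i \<in> {i1, Suc i1}" for i
    using rows[OF that] by (simp add: diagram_from_def)
  have span_PH: "?PH = span (U \<union> e ` ?D)"
    by (rule power_image_jordan_basis[OF inv(1) H sub(1) part e])
  \<comment> \<open>If both chain ends were in \<open>?PW\<close>, the first would generate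
    \<open>?PW\<close> over its hyperplane \<open>?PH\<close>. The second would then be a
    combination of independent vectors other than itself.\<close>
  have "\<exists>i\<in>{i1, Suc i1}. e (i, 0) \<notin> ?PW"
  proof (rule ccontr)
    assume "\<not> (\<exists>i\<in>{i1, Suc i1}. e (i, 0) \<notin> ?PW)"
    then have e12: "e (i1, 0) \<in> ?PW" "e (Suc i1, 0) \<in> ?PW" by auto
    have "e (i1, 0) \<notin> ?PH"
      unfolding span_PH using J mem[of i1 0] notin_D[of i1] diagram_from_subset[of \<mu> "Suc p"]
      by (intro independent_mod_notin_span[OF U fin]) auto
    then have "?PW = span (insert (e (i1, 0)) ?PH)"
      using subspace_eq_span_insert[OF PH PW power_image_mono[OF sub(2)] dim e12(1)] by blast
    also have "\<dots> = span (U \<union> e ` insert (i1, 0) ?D)"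
      unfolding span_PH by (simp add: span_breakdown_eq set_eq_iff span_span)
    finally have "e (Suc i1, 0) \<in> span (U \<union> e ` insert (i1, 0) ?D)" using e12(2) by simp
    moreover have "e (Suc i1, 0) \<notin> span (U \<union> e ` insert (i1, 0) ?D)"
      using J mem[of "Suc i1" 0] mem[of i1 0] notin_D[of "Suc i1"] diagram_from_subset[of \<mu> "Suc p"]
      by (intro independent_mod_notin_span[OF U fin]) auto
    ultimately show False by simp
  qed
  then obtain i where i: "i \<in> {i1, Suc i1}" "e (i, 0) \<notin> ?PW" by blast
  have chain: "(\<eta> ^^ k) (e (i, p)) - (if k \<le> p then e (i, p - k) else 0) \<in> U" for k
    using pow_jordan_basis[OF inv(1) _ mem[OF i(1) order_refl]] J by blast
  have "(\<eta> ^^ p) (e (i, p)) - e (i, 0) \<in> U" using chain[of p] by simp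
  then have "(\<eta> ^^ p) (e (i, p)) - e (i, 0) \<in> ?PW" by (rule power_imageI2[OF _ W])
  then have "(\<eta> ^^ p) (e (i, p)) \<notin> ?PW" using i(2) subspace_diff[OF PW] by fastforce
  moreover have "(\<eta> ^^ Suc p) (e (i, p)) \<in> U" using chain[of "Suc p"] by simp
  moreover have "e (i, p) \<in> H" using J mem[OF i(1) order_refl] by blast
  ultimately show ?thesis by blast
qed

text \<open>Modulo \<open>U\<close>, the map \<open>a\<close> below is the \<open>\<eta>\<close>-equivariant endomorphism of \<open>H\<close> that sends \<open>x\<close> to its
  \<open>\<phi>\<close>-coordinates along the chain of \<open>u\<close>; since \<open>\<phi>\<close> kills that chain, \<open>a\<close> squares to zero.\<close>

lemma exists_shear:
  assumes inv: "invariant U" "invariant L" "invariant H" "invariant W"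
    and sub: "U \<subseteq> L" "L \<subseteq> H" "H \<subseteq> W" and dim: "dim L = Suc (dim U)"
    and v: "v \<in> L" "v \<in> power_image (Suc p) W U" "v \<notin> power_image (Suc p) H U"
    and u: "u \<in> H" "(\<eta> ^^ Suc p) u \<in> U" "(\<eta> ^^ p) u \<notin> power_image (Suc p) W U"
  shows "\<exists>a. Vector_Spaces.linear scale scale a \<and> (\<forall>x. a (a x) = 0) \<and> (\<forall>x. a x \<in> H) \<and>
    (\<forall>x\<in>U. a x = 0) \<and> (\<forall>x\<in>H. a (\<eta> x) - \<eta> (a x) \<in> U) \<and> a v \<notin> power_image (Suc p) W U"
proof -
  note U = invariant_subspace[OF inv(1)] and H = invariant_subspace[OF inv(3)]
    and W = invariant_subspace[OF inv(4)]
  let ?PH = "power_image (Suc p) H U" and ?PW = "power_image (Suc p) W U"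
  note PH = subspace_power_image[OF H U, of "Suc p"] and PW = subspace_power_image[OF W U, of "Suc p"]
  have invPW: "invariant ?PW"
    unfolding invariant_def using PW eta_power_image[OF inv(1), of _ "Suc p" W]
      power_image_antimono[OF inv(4), of "Suc p" "Suc (Suc p)" U] by auto
  have high: "(\<eta> ^^ m) u \<in> U" if "m > p" for m
    using pow_mono_mem[OF inv(1) u(2)] that by simp
  \<comment> \<open>The functional must vanish on \<open>?PH\<close> and on the chain of
    \<open>u\<close> while taking the value 1 at \<open>v\<close>; hence \<open>v\<close> must lie
    outside this span.\<close>
  define Q where "Q = span (?PH \<union> (\<lambda>k. (\<eta> ^^ k) u) ` {..p})"
  have "v \<notin> Q"
  proof
    assume "v \<in> Q"
    then obtain b where b: "v - (\<Sum>k\<le>p. b k *s (\<eta> ^^ k) u) \<in> ?PH"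
      unfolding Q_def mem_span_Un_iff[OF PH finite_atMost] by blast
    let ?z = "\<Sum>k\<le>p. b k *s (\<eta> ^^ k) u"
    have "v - (v - ?z) \<in> ?PW"
      by (rule subspace_diff[OF PW v(2) subsetD[OF power_image_mono[OF sub(3)] b]])
    then have z: "?z \<in> ?PW" by simp
    have "\<forall>k\<le>p. b k = 0"
    proof (rule ccontr)
      assume "\<not> (\<forall>k\<le>p. b k = 0)"
      then have ex: "\<exists>k. k \<le> p \<and> b k \<noteq> 0" by blast
      \<comment> \<open>Applying \<eta>^(p - t) to the combination pushes all terms above
        \<open>t\<close> into \<open>U\<close>. What remains puts \<eta>^p u into
        \<open>?PW\<close>, against the choice of \<open>u\<close>.\<close>
      define t where "t = (LEAST k. k \<le> p \<and> b k \<noteq> 0)"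
      have t: "t \<le> p" "b t \<noteq> 0" using LeastI_ex[OF ex] unfolding t_def by auto
      have below: "b k = 0" if "k < t" for k
        using not_less_Least[of k "\<lambda>k. k \<le> p \<and> b k \<noteq> 0"] that t(1) unfolding t_def by auto
      have "(\<eta> ^^ (p - t)) ?z = (\<Sum>k\<le>p. b k *s (\<eta> ^^ (p - t + k)) u)"
        by (simp add: pow.sum pow.scale funpow_add del: add_diff_assoc2)
      also have "\<dots> = b t *s (\<eta> ^^ p) u + (\<Sum>k\<in>{..p} - {t}. b k *s (\<eta> ^^ (p - t + k)) u)"
        using t(1) by (subst sum.remove[of _ t]) auto
      finally have eq: "(\<eta> ^^ (p - t)) ?z =
          b t *s (\<eta> ^^ p) u + (\<Sum>k\<in>{..p} - {t}. b k *s (\<eta> ^^ (p - t + k)) u)" .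
      have rest: "(\<Sum>k\<in>{..p} - {t}. b k *s (\<eta> ^^ (p - t + k)) u) \<in> ?PW"
      proof (rule subspace_sum[OF PW])
        fix k assume k: "k \<in> {..p} - {t}"
        show "b k *s (\<eta> ^^ (p - t + k)) u \<in> ?PW"
        proof (cases "k < t")
          case True
          then show ?thesis using below subspace_0[OF PW] by simp
        next
          case False
          then have "p - t + k > p" using k t(1) by auto
          then show ?thesis
            using high by (intro subspace_scale[OF PW] power_imageI2[OF _ W])
        qed
      qed
      have "b t *s (\<eta> ^^ p) u \<in> ?PW"
        using subspace_diff[OF PW invariant_pow[OF invPW z, of "p - t"] rest] unfolding eq by simp
      then have "inverse (b t) *s b t *s (\<eta> ^^ p) u \<in> ?PW" by (rule subspace_scale[OF PW])
      then show False using u(3) t(2) by simp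
    qed
    then have "?z = 0" by (intro sum.neutral) auto
    then show False using b v(3) by simp
  qed
  then obtain \<phi> where \<phi>: "Vector_Spaces.linear scale (*) \<phi>" "\<And>x. x \<in> Q \<Longrightarrow> \<phi> x = 0" "\<phi> v = 1"
    using exists_functional[of Q v] unfolding Q_def by auto
  interpret \<phi>: Vector_Spaces.linear scale "(*)" \<phi> by (rule \<phi>(1))
  have PH_Q: "?PH \<subseteq> Q" unfolding Q_def by (auto intro: span_base)
  have U_Q: "U \<subseteq> Q" using PH_Q power_imageI2[OF _ H] by blast
  have \<phi>u: "\<phi> ((\<eta> ^^ m) u) = 0" for m
  proof (cases "m \<le> p")
    case True
    then have "(\<eta> ^^ m) u \<in> Q" unfolding Q_def by (auto intro: span_base)
    then show ?thesis by (rule \<phi>(2))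
  next
    case False
    then have "(\<eta> ^^ m) u \<in> Q" using high[of m] U_Q by auto
    then show ?thesis by (rule \<phi>(2))
  qed
  define a where "a x = (\<Sum>k\<le>p. \<phi> ((\<eta> ^^ (p - k)) x) *s (\<eta> ^^ k) u)" for x
  have "Vector_Spaces.linear scale scale a"
    unfolding a_def
    by unfold_locales (simp_all add: pow.add pow.scale \<phi>.add \<phi>.scale scale_left_distrib
        sum.distrib scale_sum_right)
  moreover have "a (a x) = 0" for x
  proof -
    have "\<phi> ((\<eta> ^^ m) (a x)) = (\<Sum>k\<le>p. \<phi> ((\<eta> ^^ (p - k)) x) * \<phi> ((\<eta> ^^ (m + k)) u))" for m
      unfolding a_def by (simp add: pow.sum pow.scale \<phi>.sum \<phi>.scale funpow_add)
    then show ?thesis unfolding a_def[of "a x"] by (simp add: \<phi>u)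
  qed
  moreover have "a x \<in> H" for x
    unfolding a_def using invariant_pow[OF inv(3) u(1)]
    by (intro subspace_sum[OF H] subspace_scale[OF H])
  moreover have "a x = 0" if "x \<in> U" for x
    unfolding a_def using invariant_pow[OF inv(1) that] U_Q \<phi>(2) by (intro sum.neutral) auto
  moreover have "a (\<eta> x) - \<eta> (a x) \<in> U" if x: "x \<in> H" for x
  proof -
    \<comment> \<open>Both sides are sums of these terms, shifted by one, so only the ends survive:
      \<open>T 0\<close> vanishes because \<eta>^(p+1) x lies in \<open>?PH\<close>, and
      \<open>T (Suc p)\<close> is a multiple of \<eta>^(p+1) u, which lies in
      \<open>U\<close>.\<close>
    define T where "T k = \<phi> ((\<eta> ^^ (Suc p - k)) x) *s (\<eta> ^^ k) u" for k
    have "a (\<eta> x) = (\<Sum>k<Suc p. T k)"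
      unfolding a_def T_def lessThan_Suc_atMost
      by (intro sum.cong) (auto simp: Suc_diff_le funpow_swap1)
    moreover have "\<eta> (a x) = (\<Sum>k<Suc p. T (Suc k))"
      unfolding a_def T_def lessThan_Suc_atMost by (simp add: eta.sum eta.scale)
    ultimately have "a (\<eta> x) - \<eta> (a x) = (\<Sum>k<Suc p. T k - T (Suc k))"
      by (simp only: sum_subtractf)
    also have "\<dots> = T 0 - T (Suc p)" by (rule sum_lessThan_telescope')
    also have "T 0 = 0"
      using power_imageI[OF x U, of "Suc p"] PH_Q \<phi>(2) unfolding T_def by auto
    finally have "a (\<eta> x) - \<eta> (a x) = - T (Suc p)" by simp
    moreover have "T (Suc p) \<in> U" unfolding T_def using u(2) by (rule subspace_scale[OF U])
    ultimately show ?thesis using subspace_neg[OF U] by simp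
  qed
  moreover have "a v = (\<eta> ^^ p) u"
  proof -
    \<comment> \<open>Since \<eta> kills the line \<open>L/U\<close>, only the summand
      \<open>k = p\<close>, with coefficient \<open>\<phi> v = 1\<close>, survives in
      \<open>a v\<close>.\<close>
    have "(\<eta> ^^ Suc 0) v \<in> U" using eta_one_step[OF inv(1,2) sub(1) dim v(1)] by simp
    then have "\<phi> ((\<eta> ^^ m) v) = 0" if "m > 0" for m
      using pow_mono_mem[OF inv(1), of "Suc 0" v m] that U_Q \<phi>(2) by auto
    then have "a v = (\<Sum>k\<le>p. if k = p then (\<eta> ^^ p) u else 0)"
      unfolding a_def using \<phi>(3) by (intro sum.cong) auto
    then show ?thesis by simp
  qed
  ultimately show ?thesis using u(3) by (intro exI[of _ a]) auto
qed

text \<open>As \<open>a\<close> squares to zero, \<open>1 - t a\<close> inverts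
  \<open>1 + t a\<close>, so the moved flags are complete. All but finitely many lie in the
  neighbourhood of \<open>f\<close> on which ranks are constant, and an infinite field leaves a
  nonzero parameter.\<close>

lemma generic_flag_shear:
  assumes "infinite (UNIV :: 'a set)" "f \<in> generic_flags"
    and a: "Vector_Spaces.linear scale scale a" "\<And>x. a (a x) = 0"
    and st: "\<And>t i. i \<le> dim UNIV \<Longrightarrow> \<eta> ` ((\<lambda>x. x + t *s a x) ` f i) \<subseteq> (\<lambda>x. x + t *s a x) ` f i"
  shows "\<exists>t. t \<noteq> 0 \<and> same_ranks f (\<lambda>i. (\<lambda>x. x + t *s a x) ` f i)"
proof -
  interpret a: Vector_Spaces.linear scale scale a by (rule a(1))
  let ?g = "\<lambda>t x. x + t *s a x"
  \<comment> \<open>Complete flags are extensional functions, hence the restriction.\<close>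
  define F where "F t = restrict (\<lambda>i. ?g t ` f i) {..dim UNIV}" for t
  obtain V where V: "openin (stable_flag_variety \<eta>) V" "f \<in> V" "\<And>h. h \<in> V \<Longrightarrow> same_ranks f h"
    using assms(2) unfolding generic_flags_def by blast
  then obtain V' where V': "openin flag_topology V'" "V = V' \<inter> stable_flags \<eta>"
    unfolding stable_flag_variety_def openin_subtopology by blast
  have f: "complete_flag f" using V(2) V'(2) by (simp add: stable_flags_def)
  have cancel: "?g (- t) (?g t x) = x" for t x
    by (simp add: a.add a.scale a(2))
  have inj: "inj (?g t)" for t by (rule inj_on_inverseI[of _ "?g (- t)"]) (rule cancel)
  have surj: "surj (?g t)" for t
    by (rule surjI[of _ "?g (- t)"]) (use cancel[of _ "- t"] in simp)
  have flag: "complete_flag (F t)" for t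
  proof -
    interpret g: Vector_Spaces.linear scale scale "?g t" by (rule linear_shear[OF a(1)])
    interpret pair: finite_dimensional_vector_space_pair_1 scale Basis scale ..
    have "subspace (?g t ` f i) \<and> dim (?g t ` f i) = i" if "i \<le> dim UNIV" for i
      using f that g.subspace_image
        pair.dim_image_eq[OF g.linear_axioms inj_on_subset[OF inj subset_UNIV]]
      unfolding complete_flag_def by metis
    moreover have "?g t ` f i \<subset> ?g t ` f (Suc i)" if "i < dim UNIV" for i
      using f that unfolding complete_flag_def psubset_eq
      by (simp add: inj_image_subset_iff[OF inj] inj_image_eq_iff[OF inj])
    ultimately show ?thesis
      using f surj g.zero unfolding complete_flag_def F_def by auto
  qed
  have "finite {t. F t \<notin> V'}"
    by (rule open_contains_curve[OF V'(1) _ a(1) flag]) (use V(2) V'(2) in \<open>auto simp: F_def\<close>)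
  then have "\<exists>t. t \<notin> insert 0 {t. F t \<notin> V'}"
    using assms(1) ex_new_if_finite finite_insert by metis
  then obtain t where t: "t \<noteq> 0" "F t \<in> V'" by auto
  have "F t \<in> stable_flags \<eta>"
    unfolding stable_flags_def using flag st[of _ t] by (auto simp: F_def)
  then have "same_ranks f (F t)" using V(3) V'(2) t(2) by blast
  then have "same_ranks f (\<lambda>i. ?g t ` f i)" unfolding same_ranks_def F_def by auto
  then show ?thesis using t(1) by blast
qed

lemma generic_flag_configuration:
  assumes "infinite (UNIV :: 'a set)" "f \<in> generic_flags" "i + j + 2 \<le> dim UNIV"
  shows "type_S1 (flag_type \<eta> f i j) (flag_type \<eta> f i (j + 1)) (flag_type \<eta> f (i + 1) j)
      (flag_type \<eta> f (i + 1) (j + 1)) \<or>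
    type_S2 (flag_type \<eta> f i j) (flag_type \<eta> f i (j + 1)) (flag_type \<eta> f (i + 1) j)
      (flag_type \<eta> f (i + 1) (j + 1))"
proof -
  \<comment> \<open>The index of \<open>H\<close>; the bound on \<open>i + j\<close> makes
    \<open>Suc i\<close> at most \<open>m\<close>, so that \<open>L\<close> lies in
    \<open>H\<close>.\<close>
  define m where "m = dim UNIV - (j + 1)"
  have m: "dim UNIV - j = Suc m" "Suc i \<le> m" "Suc m \<le> dim UNIV" "dim UNIV - (j + 1) = m"
    using assms(3) unfolding m_def by linarith+
  define U L H W where "U = f i" and "L = f (Suc i)" and "H = f m" and "W = f (Suc m)"
  have stable: "f \<in> stable_flags \<eta>" using assms(2) generic_flags_subset by blast
  note flag = stable_flagD[OF stable]
  have inv: "invariant U" "invariant L" "invariant H" "invariant W"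
    unfolding U_def L_def H_def W_def using m(2,3) by (auto intro!: flag(1) simp del: dim_UNIV)
  note U = invariant_subspace[OF inv(1)] and L = invariant_subspace[OF inv(2)]
    and H = invariant_subspace[OF inv(3)] and W = invariant_subspace[OF inv(4)]
  have sub: "U \<subseteq> L" "L \<subseteq> H" "H \<subseteq> W"
    unfolding U_def L_def H_def W_def by (rule flag(3); use m(2,3) in linarith)+
  have dims: "dim L = Suc (dim U)" "dim W = Suc (dim H)"
    unfolding U_def L_def H_def W_def using m(2,3) flag(2) by (simp_all del: dim_UNIV)
  define \<kappa> \<mu> \<mu>' \<nu> where "\<kappa> = jordan_type \<eta> W U" and "\<mu> = jordan_type \<eta> H U"
    and "\<mu>' = jordan_type \<eta> W L" and "\<nu> = jordan_type \<eta> H L"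
  have types: "flag_type \<eta> f i j = \<kappa>" "flag_type \<eta> f i (j + 1) = \<mu>"
    "flag_type \<eta> f (i + 1) j = \<mu>'" "flag_type \<eta> f (i + 1) (j + 1) = \<nu>"
    unfolding flag_type_def \<kappa>_def \<mu>_def \<mu>'_def \<nu>_def U_def L_def H_def W_def m(1,4) by simp_all
  have subs: "U \<subseteq> H" "U \<subseteq> W" "L \<subseteq> W" using sub by blast+
  have parts: "is_partition \<kappa>" "is_partition \<mu>" "is_partition \<mu>'" "is_partition \<nu>"
    unfolding \<kappa>_def \<mu>_def \<mu>'_def \<nu>_def
    using jordan_type_basis(1) inv sub subs by blast+
  note cols = column_length_jordan_type[OF inv(1,4) subs(2), folded \<kappa>_def]
    column_length_jordan_type[OF inv(1,3) subs(1), folded \<mu>_def]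
    column_length_jordan_type[OF inv(2,4) subs(3), folded \<mu>'_def]
    column_length_jordan_type[OF inv(2,3) sub(2), folded \<nu>_def]
  obtain v where v: "v \<in> L" "v \<notin> U"
    using obtain_complement_vector[OF U L sub(1) dims(1)] by blast
  obtain c where c: "\<And>k. dim (power_image k W U) = dim (power_image k H U) + (if k \<le> c then 1 else 0)"
    using dim_power_image_hyperplane[OF inv(1,3,4) subs(1) sub(3) dims(2)] by blast
  obtain c' where c': "\<And>k. v \<in> power_image k W U \<longleftrightarrow> k \<le> c'"
    "\<And>k. dim (power_image k W L) = dim (power_image k W U) + (if k \<le> c' then 0 else 1)"
    using dim_power_image_line[OF inv(1,2,4) sub(1) subs(3) v dims(1)] by blast
  obtain t where t: "\<And>k. v \<in> power_image k H U \<longleftrightarrow> k \<le> t"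
    "\<And>k. dim (power_image k H L) = dim (power_image k H U) + (if k \<le> t then 0 else 1)"
    using dim_power_image_line[OF inv(1,2,3) sub(1,2) v dims(1)] by blast
  obtain t' where t': "\<And>k. dim (power_image k W L) = dim (power_image k H L) + (if k \<le> t' then 1 else 0)"
    using dim_power_image_hyperplane[OF inv(2,3,4) sub(2,3) dims(2)] by blast
  \<comment> \<open>The four thresholds are the columns of the squares: \<open>c\<close> for
    \<kappa> - \<mu>, \<open>c'\<close> for \<kappa> - \<mu>', \<open>t\<close> for \<mu> - \<nu>
    and \<open>t'\<close> for \<mu>' - \<nu>.\<close>
  have col_c: "column_length \<kappa> k = column_length \<mu> k + (if k = c then 1 else 0)" for k
    using cols(1)[of k] cols(2)[of k] c[of k] c[of "Suc k"]
    by (cases k c rule: linorder_cases) auto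
  have col_c': "column_length \<kappa> k = column_length \<mu>' k + (if k = c' then 1 else 0)" for k
    using cols(1)[of k] cols(3)[of k] c'(2)[of k] c'(2)[of "Suc k"]
    by (cases k c' rule: linorder_cases) auto
  have col_t: "column_length \<mu> k = column_length \<nu> k + (if k = t then 1 else 0)" for k
    using cols(2)[of k] cols(4)[of k] t(2)[of k] t(2)[of "Suc k"]
    by (cases k t rule: linorder_cases) auto
  have col_t': "column_length \<mu>' k = column_length \<nu> k + (if k = t' then 1 else 0)" for k
    using cols(3)[of k] cols(4)[of k] t'[of k] t'[of "Suc k"]
    by (cases k t' rule: linorder_cases) auto
  have arr: "arrangement \<kappa> \<mu> \<mu>' \<nu>"
    unfolding arrangement_def
    using covered_by_column(1)[OF parts(1,2) col_c] covered_by_column(1)[OF parts(1,3) col_c']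
      covered_by_column(1)[OF parts(2,4) col_t] covered_by_column(1)[OF parts(3,4) col_t'] by blast
  show ?thesis
  proof (cases "\<mu> = \<mu>'")
    case False
    then show ?thesis unfolding types type_S2_def using arr by blast
  next
    case True
    then have cc: "c' = c"
      using col_c[of c] col_c'[of c] by (auto split: if_splits)
    have squares: "added_square \<mu> \<nu> = (column_length \<nu> t, t)"
      "added_square \<kappa> \<mu> = (column_length \<mu> c, c)"
      using covered_by_column(2)[OF parts(2,4) col_t] covered_by_column(2)[OF parts(1,2) col_c] by auto
    have "t \<le> c"
      using t(1)[of t] c'(1)[of t] power_image_mono[OF sub(3), of t U] cc by auto
    \<comment> \<open>Since \<eta> maps \<open>W\<close> into \<open>H\<close>, the image of a power
      on \<open>W\<close> lies in the image of the preceding power on \<open>H\<close>.\<close>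
    have "c \<le> Suc t"
    proof (cases c)
      case (Suc p)
      have "\<eta> ` W \<subseteq> H" using eta_one_step[OF inv(3,4) sub(3) dims(2)] by blast
      then have "v \<in> power_image p H U"
        using power_image_Suc_subset[of W H p U] c'(1)[of c] cc Suc by auto
      then show ?thesis using t(1) Suc by simp
    qed simp
    have "adjacent (added_square \<mu> \<nu>) (added_square \<kappa> \<mu>)"
    proof (cases "t = c")
      case True
      \<comment> \<open>The two squares are neighbours within column \<open>c\<close>.\<close>
      then show ?thesis using squares col_t[of c] by simp
    next
      case False
      then have ct: "c = Suc t" using \<open>t \<le> c\<close> \<open>c \<le> Suc t\<close> by simp
      show ?thesis
      proof (rule ccontr)
        assume "\<not> adjacent (added_square \<mu> \<nu>) (added_square \<kappa> \<mu>)"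
        then have "column_length \<nu> t \<noteq> column_length \<mu> c" using squares ct by simp
        \<comment> \<open>The squares lie in neighbouring columns, so being nonadjacent means being
          in different rows. As columns of \<nu> do not increase, column \<open>t\<close> of \<mu>
          exceeds the next by at least two, which gives two rows of length \<open>c\<close>.\<close>
        then have col2: "column_length \<mu> t \<ge> column_length \<mu> (Suc t) + 2"
          using col_t[of t] col_t[of "Suc t"] column_length_antimono[OF parts(4), of t] ct by simp
        have dimc: "dim (power_image (Suc t) W U) = Suc (dim (power_image (Suc t) H U))"
          using c[of c] ct by simp
        obtain u where u: "u \<in> H" "(\<eta> ^^ Suc t) u \<in> U" "(\<eta> ^^ t) u \<notin> power_image (Suc t) W U"
          using exists_chain_end_notin[OF inv(1,3,4) subs(1) sub(3) dimc] col2 unfolding \<mu>_def by blast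
        have v': "v \<in> power_image (Suc t) W U" "v \<notin> power_image (Suc t) H U"
          using c'(1) t(1) cc ct by auto
        obtain a where a: "Vector_Spaces.linear scale scale a" "\<And>x. a (a x) = 0" "\<And>x. a x \<in> H"
            "\<And>x. x \<in> U \<Longrightarrow> a x = 0" "\<And>x. x \<in> H \<Longrightarrow> a (\<eta> x) - \<eta> (a x) \<in> U"
            "a v \<notin> power_image (Suc t) W U"
          using exists_shear[OF inv sub dims(1) v(1) v' u] by blast
        interpret a: Vector_Spaces.linear scale scale a by (rule a(1))
        let ?g = "\<lambda>s x. x + s *s a x"
        have cancel: "?g s (?g (- s) x) = x" for s x
          by (simp add: a.diff a.scale a(2))
        have fix_low: "?g s ` f k = f k" if "k \<le> i" for s k
        proof -
          have "f k \<subseteq> U" unfolding U_def using that m(2,3) by (intro flag(3)) auto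
          then show ?thesis using a(4) by (auto simp: image_iff subset_iff)
        qed
        have fix_high: "?g s ` f k = f k" if "m \<le> k" "k \<le> dim UNIV" for s k
        proof -
          have Hk: "H \<subseteq> f k" unfolding H_def using that by (intro flag(3))
          have maps: "?g s x \<in> f k" if "x \<in> f k" for s x
            using a(3) Hk that invariant_subspace[OF flag(1)[OF \<open>k \<le> dim UNIV\<close>]]
            by (intro subspace_add subspace_scale) auto
          show ?thesis
          proof (intro equalityI subsetI)
            fix x assume "x \<in> f k"
            then have "?g (- s) x \<in> f k" by (rule maps)
            then show "x \<in> ?g s ` f k" by (rule rev_image_eqI) (rule cancel[symmetric])
          qed (use maps in auto)
        qed
        \<comment> \<open>Spaces inside \<open>U\<close> or containing \<open>H\<close> are fixed.
          In between, \<open>?g s\<close> commutes with \<eta> up to an error in \<open>U\<close>,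
          which \<open>?g s\<close> fixes and which lies in every such space.\<close>
        have stab: "\<eta> ` (?g s ` f k) \<subseteq> ?g s ` f k" if k: "k \<le> dim UNIV" for s k
        proof -
          consider "k \<le> i" | "m \<le> k" | "i \<le> k" "k \<le> m" by linarith
          then show ?thesis
          proof cases
            case 1
            then show ?thesis using fix_low flag(1)[OF k] by (simp add: invariant_def)
          next
            case 2
            then show ?thesis using fix_high k flag(1)[OF k] by (simp add: invariant_def)
          next
            case 3
            note fk = invariant_subspace[OF flag(1)[OF k]]
            have Uk: "U \<subseteq> f k" unfolding U_def using 3 k by (intro flag(3))
            have kH: "f k \<subseteq> H" unfolding H_def using 3 m(3) by (intro flag(3)) auto
            have "\<eta> (?g s x) \<in> ?g s ` f k" if x: "x \<in> f k" for x
            proof -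
              let ?w = "a (\<eta> x) - \<eta> (a x)"
              have w: "?w \<in> U" using a(5) kH x by blast
              have "a (\<eta> x - s *s ?w) = a (\<eta> x)"
                unfolding a.diff[of "\<eta> x" "s *s ?w"] a.scale[of s ?w] a(4)[OF w] by simp
              then have "\<eta> (?g s x) = ?g s (\<eta> x - s *s ?w)"
                by (simp add: eta.add eta.scale scale_right_diff_distrib)
              moreover have "\<eta> x - s *s ?w \<in> f k"
                using subspace_diff[OF fk invariant_eta[OF flag(1)[OF k] x]
                    subspace_scale[OF fk subsetD[OF Uk w]]] .
              ultimately show ?thesis by blast
            qed
            then show ?thesis by blast
          qed
        qed
        \<comment> \<open>Ranks agree with those of \<open>f\<close>, although \<open>L\<close> has
          moved while \<open>U\<close> and \<open>W\<close> stay in place; exponent \<open>c\<close>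
          gives the contradiction.\<close>
        obtain s where s: "s \<noteq> 0" "same_ranks f (\<lambda>i. ?g s ` f i)"
          using generic_flag_shear[OF assms(1,2) a(1,2) stab] by blast
        have "?g s ` W = W" unfolding W_def using fix_high[of "Suc m"] m(3) by simp
        moreover have "dim (power_image c (f (Suc m)) (f (Suc i))) =
            dim (power_image c (?g s ` f (Suc m)) (?g s ` f (Suc i)))"
          using s(2) m(2,3) unfolding same_ranks_def by simp
        ultimately have eq: "dim (power_image c W L) = dim (power_image c W (?g s ` L))"
          unfolding W_def L_def by simp
        interpret g: Vector_Spaces.linear scale scale "?g s" by (rule linear_shear[OF a(1)])
        let ?L = "?g s ` L"
        let ?P = "power_image c W ?L"
        have subL: "subspace ?L" by (rule g.subspace_image[OF L])
        have "U \<subseteq> ?L"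
        proof
          fix x assume x: "x \<in> U"
          have "x = ?g s x" using a(4)[OF x] by simp
          with subsetD[OF sub(1) x] show "x \<in> ?L" by (rule rev_image_eqI)
        qed
        then have PU: "power_image c W U \<subseteq> ?P" unfolding power_image_def by blast
        have "?g s v \<in> ?P" using v(1) by (intro power_imageI2[OF _ W]) blast
        \<comment> \<open>The vector \<open>v\<close> lies in \<eta>^c W + U but
          \<open>s a v\<close> does not, so neither does their sum.\<close>
        moreover have "?g s v \<notin> power_image c W U"
        proof
          note P = subspace_power_image[OF W U, of c]
          assume "?g s v \<in> power_image c W U"
          then have "?g s v - v \<in> power_image c W U"
            using v'(1) ct by (intro subspace_diff[OF P]) auto
          then have "s *s a v \<in> power_image c W U" by simp
          then have "inverse s *s s *s a v \<in> power_image c W U" by (rule subspace_scale[OF P])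
          then show False using s(1) a(6) ct by simp
        qed
        ultimately have "power_image c W U \<subset> ?P" using PU by blast
        then have "dim (power_image c W U) < dim ?P"
          using dim_psubset[of "power_image c W U" ?P] subspace_power_image[OF W U]
            subspace_power_image[OF W subL] by (simp add: span_eq_iff[THEN iffD2])
        \<comment> \<open>For the original \<open>L\<close> the line adds nothing at exponent
          \<open>c\<close>, the last one for which \<open>v\<close> lies in the image.\<close>
        then show False using eq c'(2)[of c] cc by simp
      qed
    qed
    then show ?thesis unfolding types type_S1_def using arr True by blast
  qed
qed

end

theorem theorem3p3:
  fixes scale :: "'k::field \<Rightarrow> 'v::ab_group_add \<Rightarrow> 'v"
    and Basis :: "'v set"
    and \<eta> :: "'v \<Rightarrow> 'v"
    and n :: nat
  assumes "infinite (UNIV :: 'k set)"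
    and "finite_dimensional_vector_space scale Basis"
    and "vector_space.dim scale (UNIV :: 'v set) = n"
    and "finite_dimensional_vector_space.nilpotent_endomorphism scale \<eta>"
  defines "X \<equiv> finite_dimensional_vector_space.stable_flag_variety scale Basis \<eta>"
    and "L \<equiv> finite_dimensional_vector_space.flag_type scale \<eta>"
  shows "\<exists>F'. openin X F' \<and> X closure_of F' = topspace X \<and>
    (\<forall>f\<in>F'. \<forall>i j. i + j + 2 \<le> n \<longrightarrow>
       type_S1 (L f i j) (L f i (j + 1)) (L f (i + 1) j) (L f (i + 1) (j + 1)) \<or>
       type_S2 (L f i j) (L f i (j + 1)) (L f (i + 1) j) (L f (i + 1) (j + 1)))"
proof -
  interpret finite_dimensional_vector_space scale Basis by (rule assms(2))
  interpret nilpotent_endo scale Basis \<eta> by unfold_locales (rule assms(4))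
  have "type_S1 (L f i j) (L f i (j + 1)) (L f (i + 1) j) (L f (i + 1) (j + 1)) \<or>
      type_S2 (L f i j) (L f i (j + 1)) (L f (i + 1) j) (L f (i + 1) (j + 1))"
    if "f \<in> generic_flags" "i + j + 2 \<le> n" for f i j
    unfolding L_def using generic_flag_configuration[OF assms(1) that(1)] that(2) assms(3) by blast
  then show ?thesis
    unfolding X_def using openin_generic_flags dense_generic_flags
    by (intro exI[of _ generic_flags]) blast
qed

end
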